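(* Let $n\in\mathbb{N}$, $\alpha\in(0,1)$ and $p\in\left(\frac{1}{1-\alpha},+\infty\right]$. If $f\in BV^{\alpha,p}(\mathbb{R}^n)$, $\varphi\in\operatorname{Lip}_c(\mathbb{R}^n;\mathbb{R}^n)$ and $x\in\mathbb{R}^n$, then $$\int_{B_r(x)}f\,\operatorname{div}^\alpha\varphi\,dy+\int_{\mathbb{R}^n}f\,\varphi\cdot\nabla^\alpha\chi_{B_r(x)}\,dy+\int_{\mathbb{R}^n}f\,\operatorname{div}^\alpha_{\rm NL}(\chi_{B_r(x)},\varphi)\,dy=-\int_{B_r(x)}\varphi\cdot dD^\alpha f$$ for $\mathcal{L}^1$-a.e. $r>0$.
   Context: $\operatorname{Lip}_c$ denotes Lipschitz maps with compact support; $B_r(x)$ is the open ball, $\chi_E$ the indicator of $E$. Let $\mu_{n,\alpha}=2^{\alpha}\pi^{-n/2}\Gamma\left(\frac{n+\alpha+1}{2}\right)/\Gamma\left(\frac{1-\alpha}{2}\right)$. Define $\operatorname{div}^\alpha\varphi(x)=\mu_{n,\alpha}\int\frac{(y-x)\cdot(\varphi(y)-\varphi(x))}{|y-x|^{n+\alpha+1}}dy$, $\nabla^\alpha g(x)=\mu_{n,\alpha}\int\frac{(y-x)(g(y)-g(x))}{|y-x|^{n+\alpha+1}}dy$, and $\operatorname{div}^\alpha_{\rm NL}(g,\varphi)(x)=\mu_{n,\alpha}\int_{\mathbb{R}^n}\frac{(g(y)-g(x))\,(y-x)\cdot(\varphi(y)-\varphi(x))}{|y-x|^{n+\alpha+1}}\,dy$,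 whenever the integrals converge. For $p\in[1,+\infty]$, $BV^{\alpha,p}(\mathbb{R}^n)$ is the set of $f\in L^p(\mathbb{R}^n)$ with $|D^\alpha f|(\mathbb{R}^n):=\sup\{\int f\operatorname{div}^\alpha\varphi\,dx:\varphi\in C^\infty_c(\mathbb{R}^n;\mathbb{R}^n),\ \|\varphi\|_{L^\infty}\le1\}<+\infty$; for such $f$, $D^\alpha f$ is the unique finite $\mathbb{R}^n$-valued Radon measure with $\int f\operatorname{div}^\alpha\varphi\,dx=-\int\varphi\cdot dD^\alpha f$ for all $\varphi\in C^\infty_c(\mathbb{R}^n;\mathbb{R}^n)$. *)

theory Defs
  imports "HOL-Analysis.Analysis"
begin

definition frac_const :: "nat \<Rightarrow> real \<Rightarrow> real" where
  "frac_const n \<alpha> = 2 powr \<alpha> * pi powr (- real n / 2)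
     * Gamma ((real n + \<alpha> + 1) / 2) / Gamma ((1 - \<alpha>) / 2)"

definition frac_div :: "real \<Rightarrow> ('a::euclidean_space \<Rightarrow> 'a) \<Rightarrow> 'a \<Rightarrow> real" where
  "frac_div \<alpha> \<phi> x = frac_const DIM('a) \<alpha> *
     (LINT y|lebesgue. ((y - x) \<bullet> (\<phi> y - \<phi> x)) / norm (y - x) powr (real DIM('a) + \<alpha> + 1))"

definition frac_grad :: "real \<Rightarrow> ('a::euclidean_space \<Rightarrow> real) \<Rightarrow> 'a \<Rightarrow> 'a" where
  "frac_grad \<alpha> g x = frac_const DIM('a) \<alpha> *\<^sub>R
     (LINT y|lebesgue. ((g y - g x) / norm (y - x) powr (real DIM('a) + \<alpha> + 1)) *\<^sub>R (y - x))"

definition frac_div_NL :: "real \<Rightarrow> ('a::euclidean_space \<Rightarrow> real) \<Rightarrow> ('a \<Rightarrow> 'a) \<Rightarrow> 'a \<Rightarrow> real" where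
  "frac_div_NL \<alpha> g \<phi> x = frac_const DIM('a) \<alpha> *
     (LINT y|lebesgue. (g y - g x) * ((y - x) \<bullet> (\<phi> y - \<phi> x))
        / norm (y - x) powr (real DIM('a) + \<alpha> + 1))"

fun pderivs :: "'a::real_normed_vector list \<Rightarrow> ('a \<Rightarrow> 'b::real_normed_vector) \<Rightarrow> 'a \<Rightarrow> 'b" where
  "pderivs [] f = f"
| "pderivs (v # vs) f = (\<lambda>x. vector_derivative (\<lambda>t. pderivs vs f (x + t *\<^sub>R v)) (at 0))"

definition smooth :: "('a::euclidean_space \<Rightarrow> 'b::real_normed_vector) \<Rightarrow> bool" where
  "smooth f \<longleftrightarrow> (\<forall>vs. set vs \<subseteq> Basis \<longrightarrow>
      continuous_on UNIV (pderivs vs f) \<and>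
      (\<forall>v\<in>Basis. \<forall>x. (\<lambda>t. pderivs vs f (x + t *\<^sub>R v)) differentiable (at 0)))"

definition has_compact_support :: "('a::euclidean_space \<Rightarrow> 'b::real_normed_vector) \<Rightarrow> bool" where
  "has_compact_support f \<longleftrightarrow> compact (closure {x. f x \<noteq> 0})"

definition test_fields :: "('a::euclidean_space \<Rightarrow> 'a) set" where
  "test_fields = {\<phi>. smooth \<phi> \<and> has_compact_support \<phi> \<and> (\<forall>x. norm (\<phi> x) \<le> 1)}"

definition Lip_c :: "('a::euclidean_space \<Rightarrow> 'b::real_normed_vector) set" where
  "Lip_c = {\<phi>. (\<exists>C. lipschitz_on C UNIV \<phi>) \<and> has_compact_support \<phi>}"

definition Lp :: "ereal \<Rightarrow> ('a::euclidean_space \<Rightarrow> real) set" where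
  "Lp p = {f. f \<in> borel_measurable lebesgue \<and>
     (if p = \<infinity> then (\<exists>C. AE x in lebesgue. \<bar>f x\<bar> \<le> C)
      else integrable lebesgue (\<lambda>x. \<bar>f x\<bar> powr real_of_ereal p))}"

definition BV_frac :: "real \<Rightarrow> ereal \<Rightarrow> ('a::euclidean_space \<Rightarrow> real) set" where
  "BV_frac \<alpha> p = {f. f \<in> Lp p \<and>
     bdd_above ((\<lambda>\<phi>. LINT x|lebesgue. f x * frac_div \<alpha> \<phi> x) ` test_fields)}"

text \<open>A finite R^n-valued Borel measure is represented as nu M, with M a finite
  positive Borel measure and nu an M-integrable density.  It is the fractional
  gradient D^alpha f when it satisfies the defining integration-by-parts identity.\<close>
definition is_frac_grad_measure ::
  "real \<Rightarrow> ('a::euclidean_space \<Rightarrow> real) \<Rightarrow> 'a measure \<Rightarrow> ('a \<Rightarrow> 'a) \<Rightarrow> bool" where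
  "is_frac_grad_measure \<alpha> f M \<nu> \<longleftrightarrow>
     sets M = sets borel \<and> finite_measure M \<and> integrable M \<nu> \<and>
     (\<forall>\<phi>. smooth \<phi> \<and> has_compact_support \<phi> \<longrightarrow>
        (LINT x|lebesgue. f x * frac_div \<alpha> \<phi> x) = - (LINT x|M. \<phi> x \<bullet> \<nu> x))"

end

theory Submission
  imports Defs
begin

text \<open>
  Mollification extends the integration by parts identity defining \<open>D\<^sup>\<alpha> f\<close> from smooth
  to Lipschitz test fields. Apply it to \<open>h\<^sub>k \<phi>\<close>, with radial Lipschitz cutoffs \<open>h\<^sub>k\<close> increasing
  to the indicator of the open ball \<open>B\<^sub>r(x)\<close>, let \<open>k\<close> tend to infinity, and split the limit by the
  fractional Leibniz rule. The only delicate term is \<open>\<phi> \<sqdot> \<nabla>\<^sup>\<alpha> h\<^sub>k\<close>: writing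
  \<open>d = \<bar>\<bar>y - x\<bar> - r\<bar>\<close>, the increments satisfy
  \<open>\<bar>h\<^sub>k(z) - h\<^sub>k(y)\<bar> \<le> min 1 (2\<bar>z - y\<bar> / d)\<close> uniformly in \<open>k\<close>,
  so the term is dominated by a multiple of \<open>\<bar>f\<bar> \<bar>\<phi>\<bar> (1 + d\<^sup>-\<^sup>\<beta>)\<close> for any \<open>\<beta>\<close> between
  \<open>\<alpha>\<close> and \<open>1\<close>. By Tonelli's theorem in \<open>(y, r)\<close> this majorant is integrable in \<open>y\<close>
  for almost every \<open>r\<close>, because \<open>\<beta> < 1\<close> and \<open>f\<close> is locally integrable.
\<close>

subsection \<open>Integrability of the truncated kernel\<close>

text \<open>The obstacle is the jump of the indicator: its fractional gradient is unbounded near the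
  sphere, and \<open>f\<close> is merely an L^p function, so a bound is sought for almost every
  radius instead of every radius. Two demands fix the exponent \<beta>. Convergence at the diagonal
  asks for increments of Hoelder order above \<alpha>; integrability of d^(-\<beta>) across the
  sphere asks for order below 1. All operators are then controlled by one kernel,
  \<open>frac_kernel\<close>, through one shape of estimate: an increment at most b(z) min(1, |z -
  y|^\<beta>) with the base point \<open>y\<close> fixed. Since only one base point is involved, the
  constant may degenerate as \<open>y\<close> approaches the sphere. The two sides of the identity
  see the sphere differently: it is Lebesgue null, but \<open>M\<close> may charge it. The cutoffs
  therefore approximate the ball from inside and converge at every point, which produces exactly the
  open ball in the integral against \<open>M\<close>.\<close>

lemma integrable_dyadic:
  fixes g :: "'a::euclidean_space \<Rightarrow> real" and \<rho> c :: "nat \<Rightarrow> real"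
  assumes g: "g \<in> borel_measurable borel" "\<And>w. 0 \<le> g w"
    and bound: "\<And>w. 0 < g w \<Longrightarrow> \<exists>k. norm w < \<rho> k \<and> g w \<le> c k"
    and nonneg: "\<And>k. 0 \<le> c k" "\<And>k. 0 \<le> \<rho> k"
    and sm: "summable (\<lambda>k. c k * \<rho> k ^ DIM('a))"
  shows "integrable lborel g"
proof -
  define V where "V = unit_ball_vol (real DIM('a))"
  have V: "0 \<le> V" by (simp add: V_def)
  \<comment> \<open>A single term of the series already bounds \<open>g\<close> at a point where it
    is positive. Zeros of \<open>g\<close> need no covering ball, so the value of a power at the
    origin causes no trouble.\<close>
  have pt: "ennreal (g w) \<le> (\<Sum>k. ennreal (c k) * indicator (ball 0 (\<rho> k)) w)" for w
  proof (cases "0 < g w")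
    case True
    then obtain k where k: "norm w < \<rho> k" "g w \<le> c k" using bound by blast
    have "ennreal (g w) \<le> ennreal (c k) * indicator (ball 0 (\<rho> k)) w"
      using k by (simp add: ennreal_leI)
    also have "\<dots> \<le> (\<Sum>k. ennreal (c k) * indicator (ball 0 (\<rho> k)) w)"
      using sum_le_suminf[of "\<lambda>k. ennreal (c k) * indicator (ball 0 (\<rho> k)) w" "{k}"]
      by (simp del: sum_mult_indicator)
    finally show ?thesis .
  next
    case False
    then show ?thesis using g(2)[of w] by simp
  qed
  have "(\<integral>\<^sup>+w. ennreal (g w) \<partial>lborel)
      \<le> (\<integral>\<^sup>+w. (\<Sum>k. ennreal (c k) * indicator (ball 0 (\<rho> k)) w) \<partial>(lborel :: 'a measure))"
    by (intro nn_integral_mono pt)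
  also have "\<dots> = (\<Sum>k. \<integral>\<^sup>+w. ennreal (c k) * indicator (ball 0 (\<rho> k)) w \<partial>(lborel::'a measure))"
    by (intro nn_integral_suminf borel_measurable_times_ennreal borel_measurable_indicator) auto
  also have "\<dots> = (\<Sum>k. ennreal (V * (c k * \<rho> k ^ DIM('a))))"
  proof (rule suminf_cong)
    fix k
    have "(\<integral>\<^sup>+w. ennreal (c k) * indicator (ball 0 (\<rho> k)) w \<partial>(lborel::'a measure))
        = ennreal (c k) * emeasure lborel (ball (0::'a) (\<rho> k))"
      by (intro nn_integral_cmult_indicator) auto
    also have "\<dots> = ennreal (V * (c k * \<rho> k ^ DIM('a)))"
      using nonneg V by (simp add: emeasure_ball V_def mult_ac flip: ennreal_mult)
    finally show "(\<integral>\<^sup>+w. ennreal (c k) * indicator (ball 0 (\<rho> k)) w \<partial>(lborel::'a measure))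
        = ennreal (V * (c k * \<rho> k ^ DIM('a)))" .
  qed
  also have "\<dots> = ennreal (\<Sum>k. V * (c k * \<rho> k ^ DIM('a)))"
    using nonneg V sm by (intro suminf_ennreal2 summable_mult) auto
  finally have "(\<integral>\<^sup>+w. ennreal (g w) \<partial>lborel) < \<infinity>"
    by (metis ennreal_less_top infinity_ennreal_def order_le_less_trans)
  then show ?thesis using g by (intro integrableI_nonneg) auto
qed

text \<open>On the shell 2^(-k-1) < |w| <= 2^(-k) the power is at most its value at the inner
  radius, as \<gamma> - n is nonpositive; multiplied by the volume this leaves a geometric series of
  ratio 2^(-\<gamma>). It serves the kernel near the diagonal with \<gamma> = \<beta> - \<alpha>
  and, in dimension one, the weight across the sphere with \<gamma> = 1 - \<beta>.\<close>

lemma integrable_norm_powr_near_0: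
  fixes \<gamma> :: real
  assumes "0 < \<gamma>" "\<gamma> \<le> 1"
  shows "integrable lborel
    (\<lambda>w::'a::euclidean_space. if norm w < 1 then norm w powr (\<gamma> - DIM('a)) else 0)"
proof (rule integrable_dyadic[where \<rho> = "\<lambda>k. 2 * (1/2)^k" and c = "\<lambda>k. ((1/2)^Suc k) powr (\<gamma> - DIM('a))"])
  fix w :: 'a
  assume "0 < (if norm w < 1 then norm w powr (\<gamma> - DIM('a)) else 0)"
  then have w: "norm w < 1" "0 < norm w" by (auto split: if_splits)
  define k where "k = (LEAST k. (1/2::real)^k < norm w)"
  have ex: "\<exists>k. (1/2::real)^k < norm w" using w by (intro real_arch_pow_inv) auto
  have k: "(1/2::real)^k < norm w" unfolding k_def using ex by (rule LeastI_ex)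
  with w have "k \<noteq> 0" by (cases k) auto
  then obtain j where j: "k = Suc j" using not0_implies_Suc by blast
  have "\<not> (1/2::real)^j < norm w" by (rule not_less_Least) (use j in \<open>simp flip: k_def\<close>)
  moreover have "(0::real) < (1/2)^j" by simp
  \<comment> \<open>Minimality gives only |w| <= 2^(-j); doubling the radius makes the inequality
    strict, as the open balls of \<open>integrable_dyadic\<close> demand.\<close>
  ultimately have *: "norm w < 2 * (1/2)^j" by linarith
  have "DIM('a) \<ge> 1" by (simp add: DIM_ge_Suc0)
  then have "\<gamma> - DIM('a) \<le> 0" using assms by linarith
  then have "norm w powr (\<gamma> - DIM('a)) \<le> ((1/2)^Suc j) powr (\<gamma> - DIM('a))"
    using k j by (intro powr_mono2') auto
  then show "\<exists>k. norm w < 2 * (1/2)^k \<and>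
      (if norm w < 1 then norm w powr (\<gamma> - DIM('a)) else 0) \<le> ((1/2)^Suc k) powr (\<gamma> - DIM('a))"
    using * w by auto
next
  have e: "((1/2)^Suc k) powr (\<gamma> - DIM('a)) * (2 * (1/2)^k) ^ DIM('a)
      = 2 ^ DIM('a) * (1/2) powr (\<gamma> - DIM('a)) * ((1/2) powr \<gamma>) ^ k" for k
  proof -
    have "((1/2)^Suc k) powr (\<gamma> - DIM('a)) * (2 * (1/2)^k) ^ DIM('a)
       = ((1/2) powr Suc k) powr (\<gamma> - DIM('a)) * (2 ^ DIM('a) * ((1/2) powr k) powr DIM('a))"
      by (simp only: powr_realpow[symmetric] power_mult_distrib powr_gt_zero zero_less_divide_1_iff
          zero_less_numeral zero_less_power)
    also have "\<dots> = 2 ^ DIM('a) * (1/2) powr (Suc k * (\<gamma> - DIM('a)) + real k * DIM('a))"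
      by (simp only: powr_add powr_powr mult_ac)
    also have "Suc k * (\<gamma> - DIM('a)) + real k * DIM('a) = (\<gamma> - DIM('a)) + \<gamma> * k"
      by (simp add: algebra_simps)
    finally show ?thesis by (simp add: powr_add powr_powr[symmetric] powr_realpow)
  qed
  have "(1/2::real) powr \<gamma> < 1"
    using assms powr_less_mono2[of \<gamma> "1/2" 1] by simp
  then show "summable (\<lambda>k. ((1/2)^Suc k) powr (\<gamma> - DIM('a)) * (2 * (1/2)^k) ^ DIM('a))"
    unfolding e by (intro summable_mult summable_geometric) auto
qed auto

lemma integrable_norm_powr_at_infinity:
  assumes "0 < \<alpha>"
  shows "integrable lborel
    (\<lambda>w::'a::euclidean_space. if norm w < 1 then 0 else norm w powr (- real DIM('a) - \<alpha>))"
proof (rule integrable_dyadic[where \<rho> = "\<lambda>k. 2^Suc k" and c = "\<lambda>k. (2^k) powr (- real DIM('a) - \<alpha>)"])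
  fix w :: 'a
  assume "0 < (if norm w < 1 then 0 else norm w powr (- real DIM('a) - \<alpha>))"
  then have w: "1 \<le> norm w" by (auto split: if_splits)
  define k where "k = (LEAST k. norm w < (2::real)^k)"
  have ex: "\<exists>k. norm w < (2::real)^k" by (intro real_arch_pow) auto
  have k: "norm w < (2::real)^k" unfolding k_def using ex by (rule LeastI_ex)
  with w have "k \<noteq> 0" by (cases k) auto
  then obtain j where j: "k = Suc j" using not0_implies_Suc by blast
  have "\<not> norm w < (2::real)^j" by (rule not_less_Least) (use j in \<open>simp flip: k_def\<close>)
  then have "norm w powr (- real DIM('a) - \<alpha>) \<le> (2^j) powr (- real DIM('a) - \<alpha>)"
    using assms by (intro powr_mono2') auto
  then show "\<exists>k. norm w < 2^Suc k \<and>
      (if norm w < 1 then 0 else norm w powr (- real DIM('a) - \<alpha>)) \<le> (2^k) powr (- real DIM('a) - \<alpha>)"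
    using k j w by auto
next
  have e: "(2^k) powr (- real DIM('a) - \<alpha>) * (2^Suc k) ^ DIM('a) = 2 ^ DIM('a) * (2 powr (-\<alpha>)) ^ k" for k
  proof -
    have "(2^k) powr (- real DIM('a) - \<alpha>) * (2^Suc k) ^ DIM('a)
       = (2 powr k) powr (- real DIM('a) - \<alpha>) * (2 powr Suc k) powr DIM('a)"
      by (simp only: powr_realpow[symmetric] powr_gt_zero zero_less_numeral zero_less_power)
    also have "\<dots> = 2 powr (k * (- real DIM('a) - \<alpha>) + real (Suc k) * DIM('a))"
      by (simp only: powr_add powr_powr mult_ac)
    also have "k * (- real DIM('a) - \<alpha>) + real (Suc k) * DIM('a) = DIM('a) + (- \<alpha>) * k"
      by (simp add: algebra_simps)
    finally show ?thesis by (simp only: powr_add powr_powr[symmetric]) (simp add: powr_realpow)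
  qed
  have "(2::real) powr (-\<alpha>) < 1"
    using assms powr_less_mono[of "-\<alpha>" 0 2] by simp
  then show "summable (\<lambda>k. (2^k) powr (- real DIM('a) - \<alpha>) * (2^Suc k) ^ DIM('a))"
    unfolding e by (intro summable_mult summable_geometric) auto
qed auto

text \<open>The vector y - x in the operators cancels one power of the denominator, leaving n +
  \<alpha>. The numerator is the size of an increment that is both bounded and \<beta>-Hoelder: the
  power gives integrability at 0 when \<alpha> < \<beta>, the 1 gives it at infinity.\<close>

definition frac_kernel :: "real \<Rightarrow> real \<Rightarrow> 'a::euclidean_space \<Rightarrow> real" where
  "frac_kernel \<alpha> \<beta> w = min 1 (norm w powr \<beta>) / norm w powr (real DIM('a) + \<alpha>)"

lemma frac_kernel_nonneg: "0 \<le> frac_kernel \<alpha> \<beta> w"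
  by (simp add: frac_kernel_def)

lemma borel_measurable_frac_kernel [measurable]: "frac_kernel \<alpha> \<beta> \<in> borel_measurable borel"
  unfolding frac_kernel_def[abs_def] by measurable

lemma integrable_frac_kernel:
  assumes "0 < \<alpha>" "\<alpha> < \<beta>" "\<beta> \<le> 1"
  shows "integrable lborel (frac_kernel \<alpha> \<beta> :: 'a::euclidean_space \<Rightarrow> real)"
proof -
  have eq: "frac_kernel \<alpha> \<beta> = (\<lambda>w::'a.
      (if norm w < 1 then norm w powr ((\<beta> - \<alpha>) - DIM('a)) else 0)
      + (if norm w < 1 then 0 else norm w powr (- real DIM('a) - \<alpha>)))"
  proof
    fix w :: 'a
    show "frac_kernel \<alpha> \<beta> w =
      (if norm w < 1 then norm w powr ((\<beta> - \<alpha>) - DIM('a)) else 0)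
      + (if norm w < 1 then 0 else norm w powr (- real DIM('a) - \<alpha>))"
    proof (cases "norm w < 1")
      case True
      then have "norm w powr \<beta> \<le> 1" using assms by (simp add: powr_le1)
      with True show ?thesis
        by (simp add: frac_kernel_def min_absorb2 powr_diff[symmetric] algebra_simps)
    next
      case False
      then have "norm w powr \<beta> \<ge> 1" using assms by (simp add: ge_one_powr_ge_zero)
      moreover have "- real DIM('a) - \<alpha> = - (real DIM('a) + \<alpha>)" by simp
      ultimately show ?thesis using False
        by (simp only: frac_kernel_def min_absorb1 powr_minus) (simp add: divide_simps)
    qed
  qed
  show ?thesis unfolding eq
    using assms by (intro Bochner_Integration.integrable_add integrable_norm_powr_near_0 integrable_norm_powr_at_infinity) auto
qed

subsection \<open>Mollification\<close>

text \<open>A class closed under coordinate derivatives contains every \<open>pderivs vs f\<close>,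
  by induction on \<open>vs\<close>; higher derivatives never have to be computed.\<close>

lemma smooth_coinduct:
  assumes "f \<in> S"
    and cont: "\<And>g. g \<in> S \<Longrightarrow> continuous_on UNIV g"
    and deriv: "\<And>g v. g \<in> S \<Longrightarrow> v \<in> Basis \<Longrightarrow>
      \<exists>g'\<in>S. \<forall>x. ((\<lambda>t. g (x + t *\<^sub>R v)) has_vector_derivative g' x) (at 0)"
  shows "smooth f"
proof -
  have *: "pderivs vs f \<in> S" if "set vs \<subseteq> Basis" for vs
    using that
  proof (induction vs)
    case Nil
    then show ?case using assms(1) by simp
  next
    case (Cons v vs)
    then obtain g' where g': "g' \<in> S"
      "\<And>x. ((\<lambda>t. pderivs vs f (x + t *\<^sub>R v)) has_vector_derivative g' x) (at 0)"
      using deriv[of "pderivs vs f" v] by auto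
    have "pderivs (v # vs) f = g'"
      using vector_derivative_at[OF g'(2)] by auto
    then show ?case using g'(1) by simp
  qed
  show ?thesis
    unfolding smooth_def
  proof (intro allI impI conjI ballI)
    fix vs :: "'a list" and v x :: 'a
    assume vs: "set vs \<subseteq> Basis"
    show "continuous_on UNIV (pderivs vs f)" using cont *[OF vs] by blast
    assume "v \<in> Basis"
    then show "(\<lambda>t. pderivs vs f (x + t *\<^sub>R v)) differentiable at 0"
      using deriv[OF *[OF vs]] differentiableI_vector by blast
  qed
qed

text \<open>\<open>flat_exp k t\<close> is \<open>t\<^sup>-\<^sup>k exp (-1/t)\<close> extended by \<open>0\<close>. The span of these functions
  is closed under differentiation, so composing with \<open>\<epsilon>\<^sup>2 - \<bar>x\<bar>\<^sup>2\<close> and multiplying by coordinates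
  gives a space of bump functions closed under partial derivatives, to which the coinduction
  principle above applies.\<close>
definition flat_exp :: "nat \<Rightarrow> real \<Rightarrow> real" where
  "flat_exp k t = (if t > 0 then exp (- inverse t) * inverse t ^ k else 0)"

lemma power_le_fact_exp:
  assumes "0 \<le> (x::real)"
  shows "x ^ n \<le> fact n * exp x"
proof -
  have "(\<Sum>k\<in>{n}. x ^ k /\<^sub>R fact k) \<le> (\<Sum>k. x ^ k /\<^sub>R fact k)"
    using assms by (intro sum_le_suminf summable_exp_generic) auto
  then have "x ^ n / fact n \<le> exp x" by (simp add: exp_def divide_inverse mult.commute)
  then show ?thesis by (simp add: divide_simps mult.commute)
qed

text \<open>In x^(k+2) <= (k+2)! exp x with x = 1/t, the two surplus powers become t^2. Quadratic
  decay is what makes the difference quotient at 0 vanish.\<close>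

lemma flat_exp_le: "\<bar>flat_exp k t\<bar> \<le> fact (k + 2) * t\<^sup>2"
proof (cases "t > 0")
  case True
  have "inverse t ^ (k + 2) \<le> fact (k + 2) * exp (inverse t)"
    using True by (intro power_le_fact_exp) auto
  then have "exp (- inverse t) * t\<^sup>2 * inverse t ^ (k + 2)
      \<le> exp (- inverse t) * t\<^sup>2 * (fact (k + 2) * exp (inverse t))"
    by (intro mult_left_mono) auto
  then show ?thesis
    using True by (simp add: flat_exp_def exp_minus power2_eq_square field_simps del: fact_Suc)
qed (simp add: flat_exp_def)

lemma flat_exp_has_derivative:
  "(flat_exp k has_real_derivative (flat_exp (k + 2) t - k * flat_exp (k + 1) t)) (at t)"
proof -
  consider "t > 0" | "t < 0" | "t = 0" by linarith
  then show ?thesis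
  proof cases
    case 1
    have "((\<lambda>t. exp (- inverse t)) has_real_derivative exp (- inverse t) * inverse t ^ 2) (at t)"
      by (rule DERIV_cong[OF DERIV_chain2[OF DERIV_exp DERIV_minus[OF DERIV_inverse]]])
        (use 1 in \<open>simp_all add: power2_eq_square\<close>)
    moreover have "((\<lambda>t. inverse t ^ k) has_real_derivative - (k * inverse t ^ (k + 1))) (at t)"
      by (rule DERIV_cong[OF DERIV_power[OF DERIV_inverse]]) (use 1 in \<open>cases k; simp add: power2_eq_square\<close>)+
    ultimately have "((\<lambda>t. exp (- inverse t) * inverse t ^ k) has_real_derivative
        (flat_exp (k + 2) t - k * flat_exp (k + 1) t)) (at t)"
      by (rule DERIV_cong[OF DERIV_mult]) (use 1 in \<open>simp add: flat_exp_def power_add power2_eq_square algebra_simps\<close>)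
    then show ?thesis
      by (rule has_field_derivative_transform_within_open[where S = "{0<..}"])
        (use 1 in \<open>auto simp: flat_exp_def\<close>)
  next
    case 2
    have "((\<lambda>t. 0) has_real_derivative (flat_exp (k + 2) t - k * flat_exp (k + 1) t)) (at t)"
      using 2 by (simp add: flat_exp_def)
    then show ?thesis
      by (rule has_field_derivative_transform_within_open[where S = "{..<0}"])
        (use 2 in \<open>auto simp: flat_exp_def\<close>)
  next
    case 3
    have lim: "((\<lambda>h. fact (k + 2) * \<bar>h\<bar>) \<longlongrightarrow> 0) (at (0::real))"
      by (intro tendsto_mult_right_zero tendsto_rabs_zero tendsto_ident_at)
    have "norm ((flat_exp k (0 + h) - flat_exp k 0) / h) \<le> fact (k + 2) * \<bar>h\<bar>" for h
    proof (cases "h = 0")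
      case False
      have "norm ((flat_exp k (0 + h) - flat_exp k 0) / h) = \<bar>flat_exp k h\<bar> / \<bar>h\<bar>"
        by (simp add: flat_exp_def[of k 0])
      also have "\<dots> \<le> (fact (k + 2) * h\<^sup>2) / \<bar>h\<bar>"
        by (intro divide_right_mono flat_exp_le) simp
      also have "\<dots> = fact (k + 2) * \<bar>h\<bar>"
        using False by (cases "h > 0") (auto simp: power2_eq_square abs_if simp del: fact_Suc)
      finally show ?thesis .
    qed simp
    from Lim_null_comparison[OF always_eventually[OF allI[OF this]] lim]
    have "((\<lambda>h. (flat_exp k (0 + h) - flat_exp k 0) / h) \<longlongrightarrow> 0) (at 0)" .
    then show ?thesis using 3 by (simp add: DERIV_def flat_exp_def)
  qed
qed

inductive_set bump_functions :: "real \<Rightarrow> ('a::euclidean_space \<Rightarrow> real) set" for \<epsilon> where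
  base: "(\<lambda>x. flat_exp k (\<epsilon>\<^sup>2 - x \<bullet> x)) \<in> bump_functions \<epsilon>"
| add: "g \<in> bump_functions \<epsilon> \<Longrightarrow> h \<in> bump_functions \<epsilon> \<Longrightarrow> (\<lambda>x. g x + h x) \<in> bump_functions \<epsilon>"
| scale: "g \<in> bump_functions \<epsilon> \<Longrightarrow> (\<lambda>x. c * g x) \<in> bump_functions \<epsilon>"
| inner: "g \<in> bump_functions \<epsilon> \<Longrightarrow> (\<lambda>x. (x \<bullet> v) * g x) \<in> bump_functions \<epsilon>"

lemma continuous_on_bump_functions:
  assumes "g \<in> bump_functions \<epsilon>"
  shows "continuous_on S g"
  using assms
proof induction
  case (base k)
  have "continuous_on UNIV (flat_exp k)"
    using flat_exp_has_derivative DERIV_isCont continuous_at_imp_continuous_on by blast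
  then have "continuous_on UNIV (\<lambda>x::'a. flat_exp k (\<epsilon>\<^sup>2 - x \<bullet> x))"
    by (rule continuous_on_compose2) (auto intro!: continuous_intros)
  then show ?case using continuous_on_subset by blast
qed (auto intro!: continuous_intros)

lemma bump_functions_eq_0:
  assumes "g \<in> bump_functions \<epsilon>" "0 < \<epsilon>" "\<epsilon> \<le> norm x"
  shows "g x = 0"
  using assms(1)
proof induction
  case (base k)
  have "\<epsilon>\<^sup>2 \<le> (norm x)\<^sup>2" using assms by (intro power_mono) auto
  then show ?case by (simp add: flat_exp_def power2_norm_eq_inner)
qed auto

text \<open>The derivative is given at every parameter \<open>s\<close> of the line, not only at 0,
  because differentiation under the integral sign needs it for all parameters.\<close>

lemma bump_functions_derivative:
  assumes "g \<in> bump_functions \<epsilon>"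
  shows "\<exists>g'\<in>bump_functions \<epsilon>. \<forall>x s. ((\<lambda>t. g (x + t *\<^sub>R v)) has_real_derivative g' (x + s *\<^sub>R v)) (at s)"
  using assms
proof induction
  case (base k)
  define g' where "g' = (\<lambda>x. (-2) * ((x \<bullet> v) * (flat_exp (k + 2) (\<epsilon>\<^sup>2 - x \<bullet> x)
      + (- real k) * flat_exp (k + 1) (\<epsilon>\<^sup>2 - x \<bullet> x))))"
  have "g' \<in> bump_functions \<epsilon>"
    unfolding g'_def by (intro bump_functions.intros)
  moreover have "((\<lambda>t. flat_exp k (\<epsilon>\<^sup>2 - (x + t *\<^sub>R v) \<bullet> (x + t *\<^sub>R v))) has_real_derivative g' (x + s *\<^sub>R v)) (at s)"
    for x s
  proof -
    have e: "(\<lambda>t. \<epsilon>\<^sup>2 - (x + t *\<^sub>R v) \<bullet> (x + t *\<^sub>R v)) = (\<lambda>t. \<epsilon>\<^sup>2 - (x \<bullet> x + 2 * (x \<bullet> v) * t + (v \<bullet> v) * t\<^sup>2))"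
      by (simp add: inner_simps inner_commute power2_eq_square algebra_simps fun_eq_iff)
    have "((\<lambda>t. \<epsilon>\<^sup>2 - (x + t *\<^sub>R v) \<bullet> (x + t *\<^sub>R v)) has_real_derivative (-2) * ((x + s *\<^sub>R v) \<bullet> v)) (at s)"
      unfolding e by (rule derivative_eq_intros refl)+ (simp add: inner_simps algebra_simps)
    from DERIV_chain2[OF flat_exp_has_derivative this, of k]
    show ?thesis by (simp add: g'_def algebra_simps)
  qed
  ultimately show ?case by blast
next
  case (add g h)
  then obtain g' h' where "g' \<in> bump_functions \<epsilon>" "h' \<in> bump_functions \<epsilon>"
    "\<And>x s. ((\<lambda>t. g (x + t *\<^sub>R v)) has_real_derivative g' (x + s *\<^sub>R v)) (at s)"
    "\<And>x s. ((\<lambda>t. h (x + t *\<^sub>R v)) has_real_derivative h' (x + s *\<^sub>R v)) (at s)"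
    by blast
  then show ?case
    by (intro bexI[of _ "\<lambda>x. g' x + h' x"]) (auto intro!: bump_functions.intros DERIV_add)
next
  case (scale g c)
  then obtain g' where "g' \<in> bump_functions \<epsilon>"
    "\<And>x s. ((\<lambda>t. g (x + t *\<^sub>R v)) has_real_derivative g' (x + s *\<^sub>R v)) (at s)"
    by blast
  then show ?case
    by (intro bexI[of _ "\<lambda>x. c * g' x"]) (auto intro!: bump_functions.intros DERIV_cmult)
next
  case (inner g w)
  then obtain g' where g': "g' \<in> bump_functions \<epsilon>"
    "\<And>x s. ((\<lambda>t. g (x + t *\<^sub>R v)) has_real_derivative g' (x + s *\<^sub>R v)) (at s)"
    by blast
  have "((\<lambda>t. ((x + t *\<^sub>R v) \<bullet> w) * g (x + t *\<^sub>R v)) has_real_derivative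
      (v \<bullet> w) * g (x + s *\<^sub>R v) + ((x + s *\<^sub>R v) \<bullet> w) * g' (x + s *\<^sub>R v)) (at s)" for x s
  proof -
    have "((\<lambda>t. x \<bullet> w + t * (v \<bullet> w)) has_real_derivative v \<bullet> w) (at s)"
      by (rule derivative_eq_intros refl | simp)+
    from DERIV_mult[OF this g'(2)[of x]] show ?thesis
      by (simp add: inner_simps algebra_simps)
  qed
  then show ?case using g'(1) inner(1)
    by (intro bexI[of _ "\<lambda>x. (v \<bullet> w) * g x + (x \<bullet> w) * g' x"]) (auto intro!: bump_functions.intros)
qed

text \<open>All derivatives fall on the bump factor, so continuity of \<phi> suffices; the fixed box
  makes every integral converge. The class closed under derivatives consists of these integrals with
  \<phi> and the box kept and the bump function varying.\<close>

lemma smooth_bump_convolution: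
  fixes \<phi> :: "'a::euclidean_space \<Rightarrow> 'b::euclidean_space"
  assumes "g \<in> bump_functions \<epsilon>" and cont: "continuous_on UNIV \<phi>"
  shows "smooth (\<lambda>x. integral (cbox a b) (\<lambda>y. g (y - x) *\<^sub>R \<phi> y))"
proof (rule smooth_coinduct[where S = "(\<lambda>g x. integral (cbox a b) (\<lambda>y. g (y - x) *\<^sub>R \<phi> y)) ` bump_functions \<epsilon>"])
  show "(\<lambda>x. integral (cbox a b) (\<lambda>y. g (y - x) *\<^sub>R \<phi> y))
      \<in> (\<lambda>g x. integral (cbox a b) (\<lambda>y. g (y - x) *\<^sub>R \<phi> y)) ` bump_functions \<epsilon>"
    using assms(1) by blast
next
  have conv: "continuous_on S (\<lambda>z. g (f z) *\<^sub>R \<phi> (h z))"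
    if "g \<in> bump_functions \<epsilon>" "continuous_on S f" "continuous_on S h"
    for g :: "'a \<Rightarrow> real" and S and f h :: "'c::topological_space \<Rightarrow> 'a"
    by (rule continuous_on_scaleR[OF continuous_on_compose2[OF continuous_on_bump_functions[OF that(1), of UNIV] that(2)]
        continuous_on_compose2[OF cont that(3)]]) auto
  {
    fix F :: "'a \<Rightarrow> 'b"
    assume "F \<in> (\<lambda>g x. integral (cbox a b) (\<lambda>y. g (y - x) *\<^sub>R \<phi> y)) ` bump_functions \<epsilon>"
    then obtain g where g: "g \<in> bump_functions \<epsilon>"
      and F: "F = (\<lambda>x. integral (cbox a b) (\<lambda>y. g (y - x) *\<^sub>R \<phi> y))" by blast
    show "continuous_on UNIV F"
      unfolding F
      by (rule integral_continuous_on_param, unfold split_beta) (intro conv[OF g] continuous_intros)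
    fix v :: 'a
    \<comment> \<open>The direction is -v because the variable x enters the integrand as y -
      x.\<close>
    obtain g' where g': "g' \<in> bump_functions \<epsilon>"
      "\<And>x s. ((\<lambda>t. g (x + t *\<^sub>R (-v))) has_real_derivative g' (x + s *\<^sub>R (-v))) (at s)"
      using bump_functions_derivative[OF g] by blast
    have "((\<lambda>t. F (x + t *\<^sub>R v)) has_vector_derivative integral (cbox a b) (\<lambda>y. g' (y - x) *\<^sub>R \<phi> y)) (at 0)" for x
    proof -
      have "((\<lambda>t. integral (cbox a b) (\<lambda>y. g (y - x + t *\<^sub>R (-v)) *\<^sub>R \<phi> y)) has_vector_derivative
          integral (cbox a b) (\<lambda>y. g' (y - x + 0 *\<^sub>R (-v)) *\<^sub>R \<phi> y)) (at 0 within UNIV)"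
      proof (rule leibniz_rule_vector_derivative)
        fix t y
        show "((\<lambda>t. g (y - x + t *\<^sub>R (-v)) *\<^sub>R \<phi> y) has_vector_derivative g' (y - x + t *\<^sub>R (-v)) *\<^sub>R \<phi> y)
            (at t within UNIV)"
          using has_vector_derivative_scaleR[OF g'(2)[of "y - x" t] has_vector_derivative_const[of "\<phi> y"]]
          by simp
        show "(\<lambda>y. g (y - x + t *\<^sub>R (-v)) *\<^sub>R \<phi> y) integrable_on cbox a b"
          by (intro integrable_continuous conv[OF g] continuous_intros)
      next
        show "continuous_on (UNIV \<times> cbox a b) (\<lambda>(t, y). g' (y - x + t *\<^sub>R (-v)) *\<^sub>R \<phi> y)"
          unfolding split_beta by (intro conv[OF g'(1)] continuous_intros)
      qed auto
      then show ?thesis by (simp add: F algebra_simps)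
    qed
    then show "\<exists>F'\<in>(\<lambda>g x. integral (cbox a b) (\<lambda>y. g (y - x) *\<^sub>R \<phi> y)) ` bump_functions \<epsilon>.
        \<forall>x. ((\<lambda>t. F (x + t *\<^sub>R v)) has_vector_derivative F' x) (at 0)"
      using g'(1) by (intro bexI[of _ "\<lambda>x. integral (cbox a b) (\<lambda>y. g' (y - x) *\<^sub>R \<phi> y)"]) auto
  }
qed

section \<open>Mollifiers and approximation of Lipschitz fields\<close>

lemma integrable_continuous_compact_support:
  fixes g :: "'a::euclidean_space \<Rightarrow> 'b::euclidean_space"
  assumes "continuous_on UNIV g" "\<And>x. R \<le> norm x \<Longrightarrow> g x = 0"
  shows "integrable lborel g"
proof -
  have "integrable lborel (\<lambda>x. indicator (cball 0 R) x *\<^sub>R g x)"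
    using assms(1) by (intro borel_integrable_compact) (auto intro: continuous_on_subset)
  moreover have "(\<lambda>x. indicator (cball 0 R) x *\<^sub>R g x) = g"
    using assms(2) by (force simp: indicator_def)
  ultimately show ?thesis by simp
qed

lemma mollifier_exists:
  assumes "0 < \<epsilon>"
  obtains \<rho> :: "'a::euclidean_space \<Rightarrow> real"
  where "\<rho> \<in> bump_functions \<epsilon>" "\<And>x. 0 \<le> \<rho> x" "integrable lborel \<rho>" "(LINT x|lborel. \<rho> x) = 1"
proof -
  define g :: "'a \<Rightarrow> real" where "g = (\<lambda>x. flat_exp 0 (\<epsilon>\<^sup>2 - x \<bullet> x))"
  have g: "g \<in> bump_functions \<epsilon>" unfolding g_def by (rule bump_functions.base)
  have int: "integrable lborel g"
    using bump_functions_eq_0[OF g assms] continuous_on_bump_functions[OF g]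
    by (intro integrable_continuous_compact_support) auto
  have nonneg: "0 \<le> g x" for x by (simp add: g_def flat_exp_def)
  have "(LINT x|lborel. g x) \<noteq> 0"
  proof
    assume "(LINT x|lborel. g x) = 0"
    then have "AE x in lborel. g x = 0"
      using int nonneg by (subst (asm) integral_nonneg_eq_0_iff_AE) auto
    moreover have "g x \<noteq> 0" if "x \<in> ball 0 \<epsilon>" for x
    proof -
      have "(norm x)\<^sup>2 < \<epsilon>\<^sup>2" using that by (intro power_strict_mono) auto
      then show ?thesis by (simp add: g_def flat_exp_def power2_norm_eq_inner)
    qed
    ultimately have "AE x in lborel. x \<notin> ball (0::'a) \<epsilon>"
      by (auto elim!: eventually_mono)
    then have "emeasure lborel (ball (0::'a) \<epsilon>) = 0"
      by (subst (asm) AE_iff_measurable[of "ball 0 \<epsilon>"]) auto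
    then show False using assms unit_ball_vol_pos[of "real DIM('a)"] by (simp add: emeasure_ball)
  qed
  moreover have "0 \<le> (LINT x|lborel. g x)" using nonneg by simp
  ultimately have pos: "0 < (LINT x|lborel. g x)" by simp
  show thesis
  proof (rule that[of "\<lambda>x. inverse (LINT x|lborel. g x) * g x"])
    show "(\<lambda>x. inverse (LINT x|lborel. g x) * g x) \<in> bump_functions \<epsilon>"
      using g by (rule bump_functions.scale)
  qed (use pos nonneg int in auto)
qed

lemma lborel_integral_shift:
  fixes g :: "'a::euclidean_space \<Rightarrow> 'b::{banach, second_countable_topology}"
  assumes [measurable]: "g \<in> borel_measurable borel"
  shows "(LINT y|lborel. g (y + x)) = (LINT w|lborel. g w)"
proof -
  have "(LINT w|lborel. g w) = (LINT w|distr lborel borel ((+) x). g w)"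
    by (simp add: lborel_distr_plus)
  also have "\<dots> = (LINT y|lborel. g (y + x))" 
    by (subst integral_distr) (auto simp: add.commute)
  finally show ?thesis by simp
qed

text \<open>An average of translates of \<phi> keeps the Lipschitz constant C. Keeping C, instead of
  just some constant, lets one majorant serve all scales of mollification.\<close>

lemma mollification:
  fixes \<phi> :: "'a::euclidean_space \<Rightarrow> 'b::euclidean_space"
  assumes lip: "C-lipschitz_on UNIV \<phi>" and supp: "\<And>x. R \<le> norm x \<Longrightarrow> \<phi> x = 0" and "0 < \<epsilon>"
  obtains \<psi> where "smooth \<psi>" "C-lipschitz_on UNIV \<psi>" "\<And>x. norm (\<psi> x - \<phi> x) \<le> C * \<epsilon>"
    "\<And>x. R + \<epsilon> \<le> norm x \<Longrightarrow> \<psi> x = 0"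
proof -
  have C: "0 \<le> C" using lip by (rule lipschitz_on_nonneg)
  have cont: "continuous_on UNIV \<phi>" using lip by (rule lipschitz_on_continuous_on)
  then have [measurable]: "\<phi> \<in> borel_measurable borel" by (rule borel_measurable_continuous_onI)
  obtain \<rho> :: "'a \<Rightarrow> real" where \<rho>: "\<rho> \<in> bump_functions \<epsilon>" "\<And>x. 0 \<le> \<rho> x"
    "integrable lborel \<rho>" "(LINT x|lborel. \<rho> x) = 1"
    using mollifier_exists[OF \<open>0 < \<epsilon>\<close>] by blast
  have [measurable]: "\<rho> \<in> borel_measurable borel"
    using \<rho>(1) by (intro borel_measurable_continuous_onI continuous_on_bump_functions)
  have \<rho>0: "\<rho> w = 0" if "\<epsilon> \<le> norm w" for w
    using bump_functions_eq_0[OF \<rho>(1) \<open>0 < \<epsilon>\<close> that] .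
  obtain a where a: "ball 0 R \<subseteq> cbox (-a) (a::'a)"
    using bounded_subset_cbox_symmetric[OF bounded_ball] by blast
  define \<psi> where "\<psi> = (\<lambda>x. integral (cbox (-a) a) (\<lambda>y. \<rho> (y - x) *\<^sub>R \<phi> y))"
  have int: "integrable lborel (\<lambda>w. \<rho> w *\<^sub>R \<phi> (x + w))" for x
    using \<rho>0 by (intro integrable_continuous_compact_support[where R = \<epsilon>])
      (auto intro!: continuous_intros continuous_on_bump_functions[OF \<rho>(1)] continuous_on_compose2[OF cont])
  \<comment> \<open>Two forms of the same function: the integral over a fixed box gives smoothness,
    while the average of translates of \<phi> with weight \<rho> gives the Lipschitz, closeness and
    support claims.\<close>
  have \<psi>: "\<psi> x = (LINT w|lborel. \<rho> w *\<^sub>R \<phi> (x + w))" for x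
  proof -
    have "continuous_on UNIV (\<lambda>y. \<rho> (y - x) *\<^sub>R \<phi> y)"
      by (auto intro!: continuous_intros continuous_on_compose2[OF continuous_on_bump_functions[OF \<rho>(1), of UNIV]] cont)
    then have i: "integrable lborel (\<lambda>y. \<rho> (y - x) *\<^sub>R \<phi> y)"
      using supp by (intro integrable_continuous_compact_support[where R = R]) auto
    have "((\<lambda>y. \<rho> (y - x) *\<^sub>R \<phi> y) has_integral (LINT y|lborel. \<rho> (y - x) *\<^sub>R \<phi> y)) UNIV"
      using i by (rule has_integral_integral_lborel)
    moreover have "\<rho> (y - x) *\<^sub>R \<phi> y = (if y \<in> cbox (-a) a then \<rho> (y - x) *\<^sub>R \<phi> y else 0)" for y
      using supp[of y] a by (force simp: subset_iff)
    ultimately have "((\<lambda>y. \<rho> (y - x) *\<^sub>R \<phi> y) has_integral (LINT y|lborel. \<rho> (y - x) *\<^sub>R \<phi> y)) (cbox (-a) a)"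
      by (subst has_integral_restrict_UNIV[symmetric]) (simp cong: if_cong)
    then have "\<psi> x = (LINT y|lborel. \<rho> (y - x) *\<^sub>R \<phi> y)"
      unfolding \<psi>_def by (rule integral_unique)
    also have "\<dots> = (LINT w|lborel. \<rho> (w + x - x) *\<^sub>R \<phi> (w + x))"
      by (rule lborel_integral_shift[symmetric]) measurable
    finally show ?thesis by (simp add: add.commute)
  qed
  show thesis
  proof (rule that[of \<psi>])
    show "smooth \<psi>" unfolding \<psi>_def by (rule smooth_bump_convolution[OF \<rho>(1) cont])
    show "norm (\<psi> x - \<phi> x) \<le> C * \<epsilon>" for x
    proof -
      have "\<psi> x - \<phi> x = (LINT w|lborel. \<rho> w *\<^sub>R \<phi> (x + w) - \<rho> w *\<^sub>R \<phi> x)"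
        using int[of x] \<rho> by (simp add: \<psi>)
      also have "norm \<dots> \<le> (LINT w|lborel. \<rho> w * (C * \<epsilon>))"
      proof (rule Bochner_Integration.integral_norm_bound_integral)
        fix w
        have "norm (\<phi> (x + w) - \<phi> x) \<le> C * \<epsilon>" if "norm w < \<epsilon>"
        proof -
          have "norm (\<phi> (x + w) - \<phi> x) \<le> C * norm w"
            using lipschitz_onD[OF lip, of "x + w" x] by (simp add: dist_norm)
          also have "\<dots> \<le> C * \<epsilon>" using that C by (intro mult_left_mono) auto
          finally show ?thesis .
        qed
        then show "norm (\<rho> w *\<^sub>R \<phi> (x + w) - \<rho> w *\<^sub>R \<phi> x) \<le> \<rho> w * (C * \<epsilon>)"
          using \<rho>0[of w] \<rho>(2)[of w]
          by (cases "norm w < \<epsilon>") (auto simp flip: scaleR_diff_right intro: mult_left_mono)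
      qed (use int \<rho> in auto)
      also have "\<dots> = C * \<epsilon>" using \<rho> by simp
      finally show ?thesis .
    qed
    show "C-lipschitz_on UNIV \<psi>"
    proof (rule lipschitz_onI)
      fix x y
      have "\<psi> x - \<psi> y = (LINT w|lborel. \<rho> w *\<^sub>R \<phi> (x + w) - \<rho> w *\<^sub>R \<phi> (y + w))"
        using int by (simp add: \<psi>)
      also have "norm \<dots> \<le> (LINT w|lborel. \<rho> w * (C * dist x y))"
      proof (rule Bochner_Integration.integral_norm_bound_integral)
        fix w
        have "norm (\<phi> (x + w) - \<phi> (y + w)) \<le> C * dist x y"
          using lipschitz_onD[OF lip, of "x + w" "y + w"] by (simp add: dist_norm)
        then show "norm (\<rho> w *\<^sub>R \<phi> (x + w) - \<rho> w *\<^sub>R \<phi> (y + w)) \<le> \<rho> w * (C * dist x y)"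
          using \<rho>(2)[of w] by (auto simp flip: scaleR_diff_right intro: mult_left_mono)
      qed (use int \<rho> in auto)
      also have "\<dots> = C * dist x y" using \<rho> by simp
      finally show "dist (\<psi> x) (\<psi> y) \<le> C * dist x y" by (simp add: dist_norm)
    qed (rule C)
    show "\<psi> x = 0" if "R + \<epsilon> \<le> norm x" for x
    proof -
      have "\<rho> w *\<^sub>R \<phi> (x + w) = 0" for w
      proof (cases "norm w < \<epsilon>")
        case True
        then have "R \<le> norm (x + w)" using that norm_triangle_ineq4[of "x + w" w] by simp
        then show ?thesis using supp by simp
      qed (simp add: \<rho>0)
      then show ?thesis by (simp only: \<psi> integral_zero)
    qed
  qed
qed

subsection \<open>Fractional operators\<close>

lemma ball_in_sets_borel [measurable]: "ball x r \<in> sets (borel :: 'a::metric_space measure)"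
  by simp

lemma lborel_integrable_shift:
  fixes g :: "'a::euclidean_space \<Rightarrow> 'b::{banach, second_countable_topology}"
  assumes "integrable lborel g"
  shows "integrable lborel (\<lambda>y. g (y + x))"
proof -
  have [measurable]: "g \<in> borel_measurable borel" using borel_measurable_integrable[OF assms] by simp
  have "integrable (distr lborel borel ((+) x)) g"
    using assms by (simp add: lborel_distr_plus)
  then show ?thesis
    by (subst (asm) integrable_distr_eq) (auto simp: add.commute)
qed

lemma frac_kernel_shift:
  assumes "0 < \<alpha>" "\<alpha> < \<beta>" "\<beta> \<le> 1"
  shows "integrable lborel (\<lambda>z::'a::euclidean_space. frac_kernel \<alpha> \<beta> (z - y))"
    and "(LINT z|lborel. frac_kernel \<alpha> \<beta> (z - y)) = (LINT w|lborel. frac_kernel \<alpha> \<beta> (w::'a))"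
  using lborel_integrable_shift[OF integrable_frac_kernel[OF assms], of "-y"]
    lborel_integral_shift[OF borel_measurable_frac_kernel, of \<alpha> \<beta> "-y"] by simp_all

lemma frac_kernel_minus_commute: "frac_kernel \<alpha> \<beta> (z - y) = frac_kernel \<alpha> \<beta> (y - z)"
  by (simp add: frac_kernel_def norm_minus_commute)

text \<open>The factor |w|, coming from Cauchy-Schwarz or from the norm of the vector, cancels one
  power. At w = 0 both sides are 0, since \<open>0 powr a = 0\<close> and division by zero gives
  0.\<close>

lemma frac_kernel_dominates:
  fixes w :: "'a::euclidean_space"
  assumes "e \<le> B * min 1 (norm w powr \<beta>)"
  shows "norm w * e / norm w powr (real DIM('a) + \<alpha> + 1) \<le> B * frac_kernel \<alpha> \<beta> w"
proof (cases "w = 0")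
  case False
  have "norm w * e / norm w powr (real DIM('a) + \<alpha> + 1) = e / norm w powr (real DIM('a) + \<alpha>)"
    using False by (simp add: powr_add)
  also have "\<dots> \<le> B * min 1 (norm w powr \<beta>) / norm w powr (real DIM('a) + \<alpha>)"
    using assms by (intro divide_right_mono) auto
  finally show ?thesis by (simp add: frac_kernel_def)
qed (simp add: frac_kernel_def)

lemma frac_integrand_bounds:
  fixes w v :: "'a::euclidean_space"
  shows "norm v \<le> B * min 1 (norm w powr \<beta>) \<Longrightarrow>
      norm ((w \<bullet> v) / norm w powr (real DIM('a) + \<alpha> + 1)) \<le> B * frac_kernel \<alpha> \<beta> w"
    and "\<bar>c\<bar> \<le> B * min 1 (norm w powr \<beta>) \<Longrightarrow>
      norm ((c / norm w powr (real DIM('a) + \<alpha> + 1)) *\<^sub>R w) \<le> B * frac_kernel \<alpha> \<beta> w"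
    and "norm v \<le> B * min 1 (norm w powr \<beta>) \<Longrightarrow> \<bar>c\<bar> \<le> 1 \<Longrightarrow>
      norm (c * (w \<bullet> v) / norm w powr (real DIM('a) + \<alpha> + 1)) \<le> B * frac_kernel \<alpha> \<beta> w"
proof -
  let ?s = "real DIM('a) + \<alpha> + 1"
  show 1: "norm ((w \<bullet> v) / norm w powr ?s) \<le> B * frac_kernel \<alpha> \<beta> w"
    if "norm v \<le> B * min 1 (norm w powr \<beta>)"
  proof -
    have "norm ((w \<bullet> v) / norm w powr ?s) \<le> norm w * norm v / norm w powr ?s"
      using Cauchy_Schwarz_ineq2[of w v] by (simp add: divide_right_mono)
    then show ?thesis using frac_kernel_dominates[OF that, of \<alpha>] by linarith
  qed
  show "norm ((c / norm w powr ?s) *\<^sub>R w) \<le> B * frac_kernel \<alpha> \<beta> w"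
    if "\<bar>c\<bar> \<le> B * min 1 (norm w powr \<beta>)"
    using frac_kernel_dominates[OF that, of \<alpha>] by (simp add: mult.commute)
  show "norm (c * (w \<bullet> v) / norm w powr ?s) \<le> B * frac_kernel \<alpha> \<beta> w"
    if "norm v \<le> B * min 1 (norm w powr \<beta>)" "\<bar>c\<bar> \<le> 1"
  proof -
    have "norm (c * (w \<bullet> v) / norm w powr ?s) = \<bar>c\<bar> * norm ((w \<bullet> v) / norm w powr ?s)"
      by (simp add: abs_mult)
    also have "\<dots> \<le> 1 * norm ((w \<bullet> v) / norm w powr ?s)"
      using that by (intro mult_right_mono) auto
    finally show ?thesis using 1[OF that(1)] by linarith
  qed
qed

text \<open>For Borel data the completed measure can be replaced by \<open>lborel\<close>, where
  integrals depending on a parameter are measurable in that parameter.\<close>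

lemma frac_div_lborel:
  assumes [measurable]: "\<psi> \<in> borel_measurable borel"
  shows "frac_div \<alpha> \<psi> (y::'a::euclidean_space) = frac_const DIM('a) \<alpha> *
    (LINT z|lborel. ((z - y) \<bullet> (\<psi> z - \<psi> y)) / norm (z - y) powr (real DIM('a) + \<alpha> + 1))"
  unfolding frac_div_def by (subst integral_completion) auto

lemma frac_grad_lborel:
  assumes [measurable]: "g \<in> borel_measurable borel"
  shows "frac_grad \<alpha> g (y::'a::euclidean_space) = frac_const DIM('a) \<alpha> *\<^sub>R
    (LINT z|lborel. ((g z - g y) / norm (z - y) powr (real DIM('a) + \<alpha> + 1)) *\<^sub>R (z - y))"
  unfolding frac_grad_def by (subst integral_completion) auto

lemma frac_div_NL_lborel:
  assumes [measurable]: "g \<in> borel_measurable borel" "\<psi> \<in> borel_measurable borel"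
  shows "frac_div_NL \<alpha> g \<psi> (y::'a::euclidean_space) = frac_const DIM('a) \<alpha> *
    (LINT z|lborel. (g z - g y) * ((z - y) \<bullet> (\<psi> z - \<psi> y)) / norm (z - y) powr (real DIM('a) + \<alpha> + 1))"
  unfolding frac_div_NL_def by (subst integral_completion) auto

lemma borel_measurable_frac_div [measurable]:
  assumes [measurable]: "\<psi> \<in> borel_measurable borel"
  shows "frac_div \<alpha> \<psi> \<in> borel_measurable borel"
  unfolding frac_div_lborel[OF assms, abs_def] by measurable

lemma borel_measurable_frac_grad [measurable]:
  assumes [measurable]: "g \<in> borel_measurable borel"
  shows "frac_grad \<alpha> g \<in> borel_measurable borel"
  unfolding frac_grad_lborel[OF assms, abs_def] by measurable

lemma borel_measurable_frac_div_NL [measurable]: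
  assumes [measurable]: "g \<in> borel_measurable borel" "\<psi> \<in> borel_measurable borel"
  shows "frac_div_NL \<alpha> g \<psi> \<in> borel_measurable borel"
  unfolding frac_div_NL_lborel[OF assms, abs_def] by measurable

lemma integral_norm_dominated:
  fixes F :: "'a \<Rightarrow> 'b::{banach, second_countable_topology}"
  assumes "integrable M b" "F \<in> borel_measurable M" "\<And>z. norm (F z) \<le> b z"
  shows "integrable M F" "norm (LINT z|M. F z) \<le> (LINT z|M. b z)"
proof -
  show "integrable M F"
  proof (rule Bochner_Integration.integrable_bound[OF assms(1,2)])
    have "norm (F z) \<le> norm (b z)" for z using assms(3)[of z] by simp
    then show "AE z in M. norm (F z) \<le> norm (b z)" by simp
  qed
  have "norm (LINT z|M. F z) \<le> (LINT z|M. norm (F z))" by (rule integral_norm_bound)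
  also have "\<dots> \<le> (LINT z|M. b z)"
    using assms \<open>integrable M F\<close> by (intro integral_mono) auto
  finally show "norm (LINT z|M. F z) \<le> (LINT z|M. b z)" .
qed

text \<open>The Hoelder factor \<open>b\<close> may vary with z: it will record that the increment
  vanishes when both points lie off the support, the source of integrability in y.\<close>

lemma frac_div_le:
  fixes y :: "'a::euclidean_space"
  assumes [measurable]: "\<psi> \<in> borel_measurable borel"
    and "integrable lborel (\<lambda>z. b z * frac_kernel \<alpha> \<beta> (z - y))"
    and "\<And>z. norm (\<psi> z - \<psi> y) \<le> b z * min 1 (norm (z - y) powr \<beta>)"
  shows "\<bar>frac_div \<alpha> \<psi> y\<bar> \<le> \<bar>frac_const DIM('a) \<alpha>\<bar> * (LINT z|lborel. b z * frac_kernel \<alpha> \<beta> (z - y))"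
proof -
  have "norm (LINT z|lborel. ((z - y) \<bullet> (\<psi> z - \<psi> y)) / norm (z - y) powr (real DIM('a) + \<alpha> + 1))
      \<le> (LINT z|lborel. b z * frac_kernel \<alpha> \<beta> (z - y))"
    by (rule integral_norm_dominated(2)[OF assms(2)]) (measurable, intro frac_integrand_bounds(1) assms(3))
  then show ?thesis
    by (simp add: frac_div_lborel abs_mult mult_left_mono)
qed

lemma frac_grad_le:
  fixes y :: "'a::euclidean_space"
  assumes [measurable]: "g \<in> borel_measurable borel"
    and "integrable lborel (\<lambda>z. b z * frac_kernel \<alpha> \<beta> (z - y))"
    and "\<And>z. \<bar>g z - g y\<bar> \<le> b z * min 1 (norm (z - y) powr \<beta>)"
  shows "norm (frac_grad \<alpha> g y) \<le> \<bar>frac_const DIM('a) \<alpha>\<bar> * (LINT z|lborel. b z * frac_kernel \<alpha> \<beta> (z - y))"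
proof -
  have "norm (LINT z|lborel. ((g z - g y) / norm (z - y) powr (real DIM('a) + \<alpha> + 1)) *\<^sub>R (z - y))
      \<le> (LINT z|lborel. b z * frac_kernel \<alpha> \<beta> (z - y))"
    by (rule integral_norm_dominated(2)[OF assms(2)]) (measurable, intro frac_integrand_bounds(2) assms(3))
  then show ?thesis
    by (simp add: frac_grad_lborel mult_left_mono)
qed

lemma frac_div_NL_le:
  fixes y :: "'a::euclidean_space"
  assumes [measurable]: "g \<in> borel_measurable borel" "\<psi> \<in> borel_measurable borel"
    and "integrable lborel (\<lambda>z. b z * frac_kernel \<alpha> \<beta> (z - y))"
    and "\<And>z. norm (\<psi> z - \<psi> y) \<le> b z * min 1 (norm (z - y) powr \<beta>)" "\<And>z. \<bar>g z - g y\<bar> \<le> 1"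
  shows "\<bar>frac_div_NL \<alpha> g \<psi> y\<bar> \<le> \<bar>frac_const DIM('a) \<alpha>\<bar> * (LINT z|lborel. b z * frac_kernel \<alpha> \<beta> (z - y))"
proof -
  have "norm (LINT z|lborel. (g z - g y) * ((z - y) \<bullet> (\<psi> z - \<psi> y)) / norm (z - y) powr (real DIM('a) + \<alpha> + 1))
      \<le> (LINT z|lborel. b z * frac_kernel \<alpha> \<beta> (z - y))"
    by (rule integral_norm_dominated(2)[OF assms(3)]) (measurable, intro frac_integrand_bounds(3) assms(4,5))
  then show ?thesis
    by (simp add: frac_div_NL_lborel abs_mult mult_left_mono)
qed

text \<open>Dominated convergence with B times the shifted kernel. The bound concerns one base
  point, so \<open>B\<close> may depend on y, as it must for cutoffs that steepen near the
  sphere.\<close>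

lemma frac_div_tendsto:
  fixes y :: "'a::euclidean_space"
  assumes "0 < \<alpha>" "\<alpha> < \<beta>" "\<beta> \<le> 1"
    and [measurable]: "\<And>k. \<psi> k \<in> borel_measurable borel"
    and bound: "\<And>k z. norm (\<psi> k z - \<psi> k y) \<le> B * min 1 (norm (z - y) powr \<beta>)"
    and lim: "\<And>z. (\<lambda>k. \<psi> k z) \<longlonglongrightarrow> \<phi> z"
  shows "(\<lambda>k. frac_div \<alpha> (\<psi> k) y) \<longlonglongrightarrow> frac_div \<alpha> \<phi> y"
proof -
  have [measurable]: "\<phi> \<in> borel_measurable borel"
    by (rule borel_measurable_LIMSEQ_metric[OF assms(4) lim])
  have "(\<lambda>k. LINT z|lborel. ((z - y) \<bullet> (\<psi> k z - \<psi> k y)) / norm (z - y) powr (real DIM('a) + \<alpha> + 1))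
     \<longlonglongrightarrow> (LINT z|lborel. ((z - y) \<bullet> (\<phi> z - \<phi> y)) / norm (z - y) powr (real DIM('a) + \<alpha> + 1))"
  proof (rule integral_dominated_convergence[where w = "\<lambda>z. B * frac_kernel \<alpha> \<beta> (z - y)"])
    show "integrable lborel (\<lambda>z. B * frac_kernel \<alpha> \<beta> (z - y))"
      by (intro integrable_mult_right frac_kernel_shift(1)[OF assms(1-3)])
    show "AE z in lborel. (\<lambda>k. ((z - y) \<bullet> (\<psi> k z - \<psi> k y)) / norm (z - y) powr (real DIM('a) + \<alpha> + 1))
        \<longlonglongrightarrow> ((z - y) \<bullet> (\<phi> z - \<phi> y)) / norm (z - y) powr (real DIM('a) + \<alpha> + 1)"
      unfolding divide_inverse
      by (intro AE_I2 tendsto_mult_right tendsto_inner tendsto_const tendsto_diff lim)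
    show "AE z in lborel. norm (((z - y) \<bullet> (\<psi> k z - \<psi> k y)) / norm (z - y) powr (real DIM('a) + \<alpha> + 1))
        \<le> B * frac_kernel \<alpha> \<beta> (z - y)" for k
      by (intro AE_I2 frac_integrand_bounds(1) bound)
  qed auto
  then show ?thesis
    by (simp add: frac_div_lborel tendsto_mult_left)
qed

text \<open>The increment of a product is h(y) times the increment of \<phi>, plus the increment of
  h times \<phi>(y), plus the product of both increments. The Hoelder bounds at y make the three
  integrals converge separately, so the rule also covers an indicator at points off the
  sphere.\<close>

lemma frac_div_leibniz:
  fixes y :: "'a::euclidean_space"
  assumes "0 < \<alpha>" "\<alpha> < \<beta>" "\<beta> \<le> 1"
    and [measurable]: "h \<in> borel_measurable borel" "\<phi> \<in> borel_measurable borel"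
    and h: "\<And>z. \<bar>h z - h y\<bar> \<le> A * min 1 (norm (z - y) powr \<beta>)" "\<And>z. \<bar>h z - h y\<bar> \<le> 1"
    and \<phi>: "\<And>z. norm (\<phi> z - \<phi> y) \<le> B * min 1 (norm (z - y) powr \<beta>)"
  shows "frac_div \<alpha> (\<lambda>z. h z *\<^sub>R \<phi> z) y
    = h y * frac_div \<alpha> \<phi> y + \<phi> y \<bullet> frac_grad \<alpha> h y + frac_div_NL \<alpha> h \<phi> y"
proof -
  let ?s = "real DIM('a) + \<alpha> + 1"
  note k = frac_kernel_shift(1)[OF assms(1-3)]
  have i1: "integrable lborel (\<lambda>z. ((z - y) \<bullet> (\<phi> z - \<phi> y)) / norm (z - y) powr ?s)"
    by (rule integral_norm_dominated(1)[where b = "\<lambda>z. B * frac_kernel \<alpha> \<beta> (z - y)"])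
      (auto intro!: k frac_integrand_bounds(1)[OF \<phi>] simp del: real_norm_def)
  have i2: "integrable lborel (\<lambda>z. ((h z - h y) / norm (z - y) powr ?s) *\<^sub>R (z - y))"
    by (rule integral_norm_dominated(1)[where b = "\<lambda>z. A * frac_kernel \<alpha> \<beta> (z - y)"])
      (measurable, auto intro!: k frac_integrand_bounds(2)[OF h(1)] simp del: norm_scaleR)
  have i3: "integrable lborel (\<lambda>z. (h z - h y) * ((z - y) \<bullet> (\<phi> z - \<phi> y)) / norm (z - y) powr ?s)"
    by (rule integral_norm_dominated(1)[where b = "\<lambda>z. B * frac_kernel \<alpha> \<beta> (z - y)"])
      (auto intro!: k frac_integrand_bounds(3)[OF \<phi> h(2)] simp del: real_norm_def)
  note j1 = integrable_mult_right[OF i1, of "h y"] and j2 = integrable_inner_right[OF i2, of "\<phi> y"]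
  have split: "((z - y) \<bullet> (h z *\<^sub>R \<phi> z - h y *\<^sub>R \<phi> y)) / norm (z - y) powr ?s
      = h y * (((z - y) \<bullet> (\<phi> z - \<phi> y)) / norm (z - y) powr ?s)
      + \<phi> y \<bullet> (((h z - h y) / norm (z - y) powr ?s) *\<^sub>R (z - y))
      + (h z - h y) * ((z - y) \<bullet> (\<phi> z - \<phi> y)) / norm (z - y) powr ?s" for z
  proof -
    have "(z - y) \<bullet> (h z *\<^sub>R \<phi> z - h y *\<^sub>R \<phi> y) = h y * ((z - y) \<bullet> (\<phi> z - \<phi> y))
      + (h z - h y) * (\<phi> y \<bullet> (z - y)) + (h z - h y) * ((z - y) \<bullet> (\<phi> z - \<phi> y))"
      by (simp add: inner_diff_right inner_commute algebra_simps)
    then show ?thesis by (simp add: add_divide_distrib)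
  qed
  have "(LINT z|lborel. ((z - y) \<bullet> (h z *\<^sub>R \<phi> z - h y *\<^sub>R \<phi> y)) / norm (z - y) powr ?s)
     = h y * (LINT z|lborel. ((z - y) \<bullet> (\<phi> z - \<phi> y)) / norm (z - y) powr ?s)
      + \<phi> y \<bullet> (LINT z|lborel. ((h z - h y) / norm (z - y) powr ?s) *\<^sub>R (z - y))
      + (LINT z|lborel. (h z - h y) * ((z - y) \<bullet> (\<phi> z - \<phi> y)) / norm (z - y) powr ?s)"
    unfolding split
      Bochner_Integration.integral_add[OF Bochner_Integration.integrable_add[OF j1 j2] i3]
      Bochner_Integration.integral_add[OF j1 j2] integral_mult_right_zero integral_inner_right[OF i2] ..
  then show ?thesis
    by (simp add: frac_div_lborel frac_grad_lborel frac_div_NL_lborel algebra_simps)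
qed

text \<open>Dominates, up to a constant depending only on the Lipschitz and sup norms, the fractional
  divergence of every Lipschitz field supported in the ball of radius \<open>R\<close>. It is both bounded and
  integrable, hence pairs with every \<open>L\<^sup>p\<close> function.\<close>
definition support_majorant :: "real \<Rightarrow> real \<Rightarrow> real \<Rightarrow> 'a::euclidean_space \<Rightarrow> real" where
  "support_majorant \<alpha> \<beta> R y =
    (LINT z|lborel. (indicator (ball 0 R) z + indicator (ball 0 R) y) * frac_kernel \<alpha> \<beta> (z - y))"

section \<open>Boundedness and integrability of the support majorant\<close>

context
  fixes \<alpha> \<beta> :: real
  assumes exponents: "0 < \<alpha>" "\<alpha> < \<beta>" "\<beta> \<le> 1"
begin

lemma integrable_indicator_frac_kernel:
  "integrable lborel (\<lambda>z::'a::euclidean_space. indicator (ball 0 R) z * frac_kernel \<alpha> \<beta> (z - y))"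
proof (rule integral_norm_dominated(1)[OF frac_kernel_shift(1)[OF exponents]])
  show "norm (indicator (ball 0 R) z * frac_kernel \<alpha> \<beta> (z - y)) \<le> frac_kernel \<alpha> \<beta> (z - y)" for z :: 'a
    using frac_kernel_nonneg[of \<alpha> \<beta> "z - y"] by (simp add: indicator_def)
qed measurable

lemma integrable_support_majorant_integrand:
  "integrable lborel (\<lambda>z::'a::euclidean_space.
    (indicator (ball 0 R) z + indicator (ball 0 R) y) * frac_kernel \<alpha> \<beta> (z - y))"
  unfolding distrib_right
  by (intro Bochner_Integration.integrable_add integrable_indicator_frac_kernel integrable_mult_right
      frac_kernel_shift(1)[OF exponents])

lemma support_majorant_eq:
  "support_majorant \<alpha> \<beta> R (y::'a::euclidean_space) =
    (LINT z|lborel. indicator (ball 0 R) z * frac_kernel \<alpha> \<beta> (z - y))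
    + indicator (ball 0 R) y * (LINT w|lborel. frac_kernel \<alpha> \<beta> (w::'a))"
  unfolding support_majorant_def distrib_right
    Bochner_Integration.integral_add[OF integrable_indicator_frac_kernel
      integrable_mult_right[OF frac_kernel_shift(1)[OF exponents]]]
  by (simp add: frac_kernel_shift(2)[OF exponents])

lemma support_majorant_nonneg: "0 \<le> support_majorant \<alpha> \<beta> R y"
  unfolding support_majorant_def by (intro integral_nonneg_AE AE_I2 mult_nonneg_nonneg frac_kernel_nonneg) auto

lemma support_majorant_le:
  "support_majorant \<alpha> \<beta> R (y::'a::euclidean_space) \<le> 2 * (LINT w|lborel. frac_kernel \<alpha> \<beta> (w::'a))"
proof -
  have "support_majorant \<alpha> \<beta> R y \<le> (LINT z|lborel. 2 * frac_kernel \<alpha> \<beta> (z - y))"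
    unfolding support_majorant_def
  proof (rule integral_mono[OF integrable_support_majorant_integrand])
    show "integrable lborel (\<lambda>z. 2 * frac_kernel \<alpha> \<beta> (z - y))"
      by (intro integrable_mult_right frac_kernel_shift(1)[OF exponents])
    show "(indicator (ball 0 R) z + indicator (ball 0 R) y) * frac_kernel \<alpha> \<beta> (z - y)
        \<le> 2 * frac_kernel \<alpha> \<beta> (z - y)" for z
      by (intro mult_right_mono frac_kernel_nonneg) (auto simp: indicator_def)
  qed
  then show ?thesis by (simp add: frac_kernel_shift(2)[OF exponents])
qed

text \<open>By Fubini, integrating the kernel first in y gives a constant for every z, and the ball
  has finite volume; the other half of the majorant is a multiple of an indicator.\<close>

lemma integrable_support_majorant:
  "integrable lborel (support_majorant \<alpha> \<beta> R :: 'a::euclidean_space \<Rightarrow> real)"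
proof -
  let ?f = "\<lambda>z y::'a. indicator (ball 0 R) z * frac_kernel \<alpha> \<beta> (z - y)"
  have ball: "integrable lborel (indicator (ball (0::'a) R) :: 'a \<Rightarrow> real)"
    using emeasure_bounded_finite[OF bounded_ball[of "0::'a" R]] by (simp add: integrable_indicator_iff)
  have meas: "case_prod ?f \<in> borel_measurable (lborel \<Otimes>\<^sub>M lborel)"
    by measurable
  have "integrable (lborel \<Otimes>\<^sub>M lborel) (case_prod ?f)"
  proof (rule lborel_pair.Fubini_integrable[OF meas])
    have "(LINT y|lborel. norm (case_prod ?f (z, y))) =
        indicator (ball 0 R) z * (LINT w|lborel. frac_kernel \<alpha> \<beta> (w::'a))" for z
      using frac_kernel_shift(2)[OF exponents, of z]
      by (simp add: abs_mult abs_of_nonneg[OF frac_kernel_nonneg] frac_kernel_minus_commute[of \<alpha> \<beta> z])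
    then show "integrable lborel (\<lambda>z. LINT y|lborel. norm (case_prod ?f (z, y)))"
      using ball by simp
    show "AE z in lborel. integrable lborel (\<lambda>y. case_prod ?f (z, y))"
    proof (rule AE_I2)
      fix z :: 'a
      have "integrable lborel (\<lambda>y. indicator (ball 0 R) z * frac_kernel \<alpha> \<beta> (y - z))"
        by (rule integrable_mult_right[OF frac_kernel_shift(1)[OF exponents]])
      then show "integrable lborel (\<lambda>y. case_prod ?f (z, y))"
        unfolding split frac_kernel_minus_commute[of \<alpha> \<beta> z] .
    qed
  qed
  then have "integrable lborel (\<lambda>y. LINT z|lborel. ?f z y)"
    by (rule lborel_pair.integrable_snd)
  then show ?thesis
    unfolding support_majorant_eq[abs_def] using ball by simp
qed

end

section \<open>Pairing with L^p functions\<close>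

lemma borel_measurable_imp_lebesgue:
  "g \<in> borel_measurable borel \<Longrightarrow> g \<in> borel_measurable lebesgue"
  by (simp add: measurable_completion)

text \<open>For finite p, |f| <= 1 + |f|^p, so |f| G <= G + K |f|^p: a majorant that is both
  integrable and bounded replaces Hoelder's inequality and treats all finite exponents
  alike.\<close>

lemma Lp_mult_integrable:
  fixes f :: "'a::euclidean_space \<Rightarrow> real"
  assumes f: "f \<in> Lp p" and "1 \<le> p"
    and g: "g \<in> borel_measurable lebesgue" "AE y in lebesgue. \<bar>g y\<bar> \<le> G y"
    and G: "integrable lborel G" "\<And>y. 0 \<le> G y" "\<And>y. G y \<le> K"
  shows "integrable lebesgue (\<lambda>y. f y * g y)"
proof -
  have [measurable]: "f \<in> borel_measurable lebesgue" "g \<in> borel_measurable lebesgue"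
    using f g by (auto simp: Lp_def)
  have Gl: "integrable lebesgue G" using G(1) by (subst integrable_completion) auto
  show ?thesis
  proof (cases "p = \<infinity>")
    case True
    then obtain C where C: "AE x in lebesgue. \<bar>f x\<bar> \<le> C" using f by (auto simp: Lp_def)
    show ?thesis
    proof (rule Bochner_Integration.integrable_bound)
      show "integrable lebesgue (\<lambda>y. C * G y)" using Gl by simp
      show "AE y in lebesgue. norm (f y * g y) \<le> norm (C * G y)"
        using C g(2)
      proof eventually_elim
        case (elim y)
        then have "\<bar>f y\<bar> * \<bar>g y\<bar> \<le> C * G y" by (intro mult_mono) auto
        then show ?case using abs_ge_self[of "C * G y"] by (simp only: real_norm_def abs_mult[of "f y"])
      qed
    qed measurable
  next
    case False
    with \<open>1 \<le> p\<close> obtain q where q: "p = ereal q" "1 \<le> q" by (cases p) auto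
    have int: "integrable lebesgue (\<lambda>x. \<bar>f x\<bar> powr q)" using f q by (auto simp: Lp_def)
    have le: "\<bar>t\<bar> \<le> 1 + \<bar>t\<bar> powr q" for t :: real
    proof (cases "\<bar>t\<bar> \<le> 1")
      case True
      then show ?thesis using powr_ge_zero[of "\<bar>t\<bar>" q] by linarith
    next
      case False
      then have "\<bar>t\<bar> powr 1 \<le> \<bar>t\<bar> powr q" using q by (intro powr_mono) auto
      then show ?thesis using False by simp
    qed
    show ?thesis
    proof (rule Bochner_Integration.integrable_bound)
      show "integrable lebesgue (\<lambda>y. G y + \<bar>f y\<bar> powr q * K)" using Gl int by simp
      show "AE y in lebesgue. norm (f y * g y) \<le> norm (G y + \<bar>f y\<bar> powr q * K)"
        using g(2)
      proof eventually_elim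
        case (elim y)
        have "\<bar>f y\<bar> * \<bar>g y\<bar> \<le> (1 + \<bar>f y\<bar> powr q) * G y"
          using elim le by (intro mult_mono) auto
        also have "\<dots> \<le> G y + \<bar>f y\<bar> powr q * K"
          using G(3)[of y] by (simp add: distrib_right mult_left_mono)
        finally show ?case by (simp add: abs_mult)
      qed
    qed measurable
  qed
qed

section \<open>Compactly supported Lipschitz fields and integration by parts\<close>

lemma Lip_cE:
  fixes \<phi> :: "'a::euclidean_space \<Rightarrow> 'b::real_normed_vector"
  assumes "\<phi> \<in> Lip_c"
  obtains C R S where "C-lipschitz_on UNIV \<phi>" "0 < R" "0 \<le> S"
    "\<And>x. R \<le> norm x \<Longrightarrow> \<phi> x = 0" "\<And>x. norm (\<phi> x) \<le> S"
proof -
  obtain C where C: "C-lipschitz_on UNIV \<phi>" using assms by (auto simp: Lip_c_def)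
  have "compact (closure {x. \<phi> x \<noteq> 0})" using assms by (simp add: Lip_c_def has_compact_support_def)
  then have "bounded {x. \<phi> x \<noteq> 0}"
    by (rule bounded_subset[OF compact_imp_bounded closure_subset])
  then obtain R where R: "0 < R" "\<And>x. \<phi> x \<noteq> 0 \<Longrightarrow> norm x < R"
    unfolding bounded_pos_less by auto
  have "bounded (\<phi> ` cball 0 R)"
    by (intro compact_imp_bounded compact_continuous_image compact_cball
        continuous_on_subset[OF lipschitz_on_continuous_on[OF C]]) auto
  then obtain S where S: "0 < S" "\<And>x. x \<in> cball 0 R \<Longrightarrow> norm (\<phi> x) \<le> S"
    unfolding bounded_pos by auto
  have "norm (\<phi> x) \<le> S" for x
    using S(2)[of x] R(2)[of x] S(1) by (cases "\<phi> x = 0") auto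
  then show thesis
    using that[OF C R(1), of S] R(2) S(1) by force
qed

lemma Lip_cI:
  assumes "C-lipschitz_on UNIV \<phi>" "\<And>x. R \<le> norm x \<Longrightarrow> \<phi> x = 0"
  shows "\<phi> \<in> Lip_c" and "has_compact_support \<phi>"
proof -
  have "{x. \<phi> x \<noteq> 0} \<subseteq> ball 0 R" using assms(2) by force
  then have "bounded {x. \<phi> x \<noteq> 0}" using bounded_ball bounded_subset by blast
  then show "has_compact_support \<phi>" by (simp add: has_compact_support_def compact_closure)
  then show "\<phi> \<in> Lip_c" using assms(1) by (auto simp: Lip_c_def)
qed

text \<open>At distance at most 1 the Lipschitz bound wins, because |w| <= |w|^\<beta> there; beyond
  it the bound 2 S does. The sum C + 2 S covers both ranges.\<close>

lemma lipschitz_bounded_holder: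
  fixes \<phi> :: "'a::euclidean_space \<Rightarrow> 'b::real_normed_vector"
  assumes C: "C-lipschitz_on UNIV \<phi>" and S: "\<And>x. norm (\<phi> x) \<le> S"
    and "0 < \<beta>" "\<beta> \<le> 1"
  shows "norm (\<phi> z - \<phi> y) \<le> (C + 2 * S) * min 1 (norm (z - y) powr \<beta>)"
proof -
  have nonneg: "0 \<le> C" "0 \<le> S"
    using lipschitz_on_nonneg[OF C] order_trans[OF norm_ge_zero S] by auto
  have 1: "norm (\<phi> z - \<phi> y) \<le> C * norm (z - y)"
    using lipschitz_onD[OF C, of z y] by (simp add: dist_norm)
  have 2: "norm (\<phi> z - \<phi> y) \<le> 2 * S"
    using norm_triangle_ineq4[of "\<phi> z" "\<phi> y"] S[of z] S[of y] by linarith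
  show ?thesis
  proof (cases "norm (z - y) \<le> 1")
    case True
    then have "norm (z - y) powr \<beta> \<le> 1" using assms by (simp add: powr_le1)
    moreover have "norm (z - y) \<le> norm (z - y) powr \<beta>"
      using True powr_mono'[of \<beta> 1 "norm (z - y)"] assms by simp
    then have "C * norm (z - y) \<le> (C + 2 * S) * norm (z - y) powr \<beta>"
      using nonneg by (intro mult_mono) auto
    ultimately show ?thesis using 1 by (simp add: min_absorb2)
  next
    case False
    then have "1 \<le> norm (z - y) powr \<beta>" using assms by (simp add: ge_one_powr_ge_zero)
    then show ?thesis using 2 nonneg by (simp add: min_absorb1)
  qed
qed

lemma lipschitz_compact_support_holder:
  fixes \<phi> :: "'a::euclidean_space \<Rightarrow> 'b::real_normed_vector"
  assumes C: "C-lipschitz_on UNIV \<phi>" and S: "\<And>x. norm (\<phi> x) \<le> S"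
    and R: "\<And>x. R \<le> norm x \<Longrightarrow> \<phi> x = 0"
    and \<beta>: "0 < \<beta>" "\<beta> \<le> 1"
  shows "norm (\<phi> z - \<phi> y)
    \<le> ((C + 2 * S) * (indicator (ball 0 R) z + indicator (ball 0 R) y)) * min 1 (norm (z - y) powr \<beta>)"
proof (cases "z \<in> ball 0 R \<or> y \<in> ball 0 R")
  case True
  have nonneg: "0 \<le> C" "0 \<le> S"
    using lipschitz_on_nonneg[OF C] order_trans[OF norm_ge_zero S] by auto
  have "1 \<le> indicator (ball 0 R) z + (indicator (ball 0 R) y :: real)"
    using True by (auto simp: indicator_def)
  then have "(C + 2 * S) * 1 \<le> (C + 2 * S) * (indicator (ball 0 R) z + indicator (ball 0 R) y)"
    using nonneg by (intro mult_left_mono) auto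
  then have "(C + 2 * S) * min 1 (norm (z - y) powr \<beta>)
      \<le> ((C + 2 * S) * (indicator (ball 0 R) z + indicator (ball 0 R) y)) * min 1 (norm (z - y) powr \<beta>)"
    by (intro mult_right_mono) auto
  then show ?thesis using lipschitz_bounded_holder[OF C S \<beta>, of z y] by linarith
next
  case False
  then show ?thesis using R[of z] R[of y] by simp
qed

lemma frac_div_le_support_majorant:
  fixes y :: "'a::euclidean_space"
  assumes \<alpha>\<beta>: "0 < \<alpha>" "\<alpha> < \<beta>" "\<beta> \<le> 1"
    and C: "C-lipschitz_on UNIV \<phi>" and S: "\<And>x. norm (\<phi> x) \<le> S"
    and R: "\<And>x. R \<le> norm x \<Longrightarrow> \<phi> x = 0"
  shows "\<bar>frac_div \<alpha> \<phi> y\<bar> \<le> \<bar>frac_const DIM('a) \<alpha>\<bar> * ((C + 2 * S) * support_majorant \<alpha> \<beta> R y)"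
    and "g \<in> borel_measurable borel \<Longrightarrow> (\<And>z. \<bar>g z - g y\<bar> \<le> 1) \<Longrightarrow>
      \<bar>frac_div_NL \<alpha> g \<phi> y\<bar> \<le> \<bar>frac_const DIM('a) \<alpha>\<bar> * ((C + 2 * S) * support_majorant \<alpha> \<beta> R y)"
proof -
  let ?b = "\<lambda>z. (C + 2 * S) * (indicator (ball 0 R) z + indicator (ball 0 R) y)"
  have [measurable]: "\<phi> \<in> borel_measurable borel"
    using lipschitz_on_continuous_on[OF C] by (rule borel_measurable_continuous_onI)
  have int: "integrable lborel (\<lambda>z. ?b z * frac_kernel \<alpha> \<beta> (z - y))"
    unfolding mult.assoc by (intro integrable_mult_right integrable_support_majorant_integrand[OF \<alpha>\<beta>])
  have eq: "(LINT z|lborel. ?b z * frac_kernel \<alpha> \<beta> (z - y)) = (C + 2 * S) * support_majorant \<alpha> \<beta> R y"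
    unfolding mult.assoc support_majorant_def by simp
  have \<beta>: "0 < \<beta>" using \<alpha>\<beta> by simp
  note hol = lipschitz_compact_support_holder[OF C S R \<beta> \<alpha>\<beta>(3)]
  show "\<bar>frac_div \<alpha> \<phi> y\<bar> \<le> \<bar>frac_const DIM('a) \<alpha>\<bar> * ((C + 2 * S) * support_majorant \<alpha> \<beta> R y)"
    using frac_div_le[OF _ int hol] unfolding eq by simp
  show "\<bar>frac_div_NL \<alpha> g \<phi> y\<bar> \<le> \<bar>frac_const DIM('a) \<alpha>\<bar> * ((C + 2 * S) * support_majorant \<alpha> \<beta> R y)"
    if "g \<in> borel_measurable borel" "\<And>z. \<bar>g z - g y\<bar> \<le> 1"
    using frac_div_NL_le[OF that(1) _ int hol that(2)] unfolding eq by simp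
qed

text \<open>The defining identity of the measure knows only smooth fields, but the cutoffs are
  Lipschitz. Mollifications at scales at most 1 share a Lipschitz constant, a sup bound and a
  support ball, so one majorant passes both integrals to the limit.\<close>

lemma frac_integration_by_parts_Lip_c:
  fixes f :: "'a::euclidean_space \<Rightarrow> real"
  assumes \<alpha>: "0 < \<alpha>" "\<alpha> < 1" and f: "f \<in> Lp p" "1 \<le> p"
    and M: "is_frac_grad_measure \<alpha> f M \<nu>" and \<phi>: "\<phi> \<in> Lip_c"
  shows "(LINT x|lebesgue. f x * frac_div \<alpha> \<phi> x) = - (LINT x|M. \<phi> x \<bullet> \<nu> x)"
proof -
  obtain C R S where C: "C-lipschitz_on UNIV \<phi>" and "0 < R" "0 \<le> S"
    and R: "\<And>x. R \<le> norm x \<Longrightarrow> \<phi> x = 0" and S: "\<And>x. norm (\<phi> x) \<le> S"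
    using Lip_cE[OF \<phi>] by blast
  have C0: "0 \<le> C" using lipschitz_on_nonneg[OF C] .
  have "\<exists>\<psi>. smooth \<psi> \<and> C-lipschitz_on UNIV \<psi> \<and> (\<forall>x. norm (\<psi> x - \<phi> x) \<le> C * inverse (real (Suc k))) \<and>
      (\<forall>x. R + inverse (real (Suc k)) \<le> norm x \<longrightarrow> \<psi> x = 0)" for k
  proof -
    have "0 < inverse (real (Suc k))" by simp
    from mollification[OF C R this] show ?thesis by blast
  qed
  then obtain \<psi> where \<psi>: "\<And>k. smooth (\<psi> k)" "\<And>k. C-lipschitz_on UNIV (\<psi> k)"
    "\<And>k x. norm (\<psi> k x - \<phi> x) \<le> C * inverse (real (Suc k))"
    "\<And>k x. R + inverse (real (Suc k)) \<le> norm x \<Longrightarrow> \<psi> k x = 0"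
    by metis
  have inv1: "inverse (real (Suc k)) \<le> 1" for k by (simp add: inverse_le_1_iff)
  have supp: "\<psi> k x = 0" if "R + 1 \<le> norm x" for k x
    using \<psi>(4)[of k x] inv1[of k] that by linarith
  have bd: "norm (\<psi> k x) \<le> S + C" for k x
  proof -
    have "norm (\<psi> k x) \<le> norm (\<phi> x) + norm (\<psi> k x - \<phi> x)"
      using norm_triangle_sub[of "\<psi> k x" "\<phi> x"] by simp
    moreover have "C * inverse (real (Suc k)) \<le> C * 1" using C0 inv1 by (intro mult_left_mono)
    ultimately show ?thesis using S[of x] \<psi>(3)[of k x] by linarith
  qed
  have lim: "(\<lambda>k. \<psi> k x) \<longlonglongrightarrow> \<phi> x" for x
  proof (rule LIM_zero_cancel, rule Lim_null_comparison)
    show "\<forall>\<^sub>F k in sequentially. norm (\<psi> k x - \<phi> x) \<le> C * inverse (real (Suc k))"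
      using \<psi>(3) by simp
    show "(\<lambda>k. C * inverse (real (Suc k))) \<longlonglongrightarrow> 0"
      by (intro tendsto_mult_right_zero LIMSEQ_inverse_real_of_nat)
  qed
  have [measurable]: "\<And>k. \<psi> k \<in> borel_measurable borel" "\<phi> \<in> borel_measurable borel"
    using lipschitz_on_continuous_on[OF \<psi>(2)] lipschitz_on_continuous_on[OF C]
    by (auto intro: borel_measurable_continuous_onI)
  have [measurable]: "f \<in> borel_measurable lebesgue" using f by (simp add: Lp_def)
  have fm: "sets M = sets borel" "finite_measure M" "integrable M \<nu>"
    and ibp: "\<And>\<phi>. smooth \<phi> \<Longrightarrow> has_compact_support \<phi> \<Longrightarrow>
        (LINT x|lebesgue. f x * frac_div \<alpha> \<phi> x) = - (LINT x|M. \<phi> x \<bullet> \<nu> x)"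
    using M by (auto simp: is_frac_grad_measure_def)
  have [measurable_cong]: "sets M = sets borel" by (rule fm)
  have [measurable]: "\<nu> \<in> borel_measurable M" using fm(3) by simp
  \<comment> \<open>Here the exponent \<beta> = 1 is available: the fields are uniformly Lipschitz,
    \<alpha> < 1, and no sphere is involved yet.\<close>
  let ?G = "\<lambda>y::'a. \<bar>frac_const DIM('a) \<alpha>\<bar> * ((C + 2 * (S + C)) * support_majorant \<alpha> 1 (R + 1) y)"
  have A: "0 \<le> C + 2 * (S + C)" using C0 \<open>0 \<le> S\<close> by simp
  have \<alpha>\<beta>: "0 < \<alpha>" "\<alpha> < 1" "(1::real) \<le> 1" using \<alpha> by auto
  have G: "integrable lborel ?G" "\<And>y. 0 \<le> ?G y"
    "\<And>y. ?G y \<le> \<bar>frac_const DIM('a) \<alpha>\<bar> * ((C + 2 * (S + C)) * (2 * (LINT w|lborel. frac_kernel \<alpha> 1 (w::'a))))"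
    using A integrable_support_majorant[OF \<alpha>\<beta>, where 'a = 'a]
      support_majorant_nonneg[OF \<alpha>\<beta>, where 'a = 'a] support_majorant_le[OF \<alpha>\<beta>, where 'a = 'a]
    by (auto intro!: mult_left_mono)
  have G': "\<bar>frac_div \<alpha> (\<psi> k) y\<bar> \<le> ?G y" for k y
    by (rule frac_div_le_support_majorant(1)[OF \<alpha>\<beta> \<psi>(2) bd supp])
  have fG: "integrable lebesgue (\<lambda>y. f y * ?G y)"
    by (rule Lp_mult_integrable[OF f _ _ G])
      (intro measurable_completion borel_measurable_integrable[OF G(1)]
        AE_I2 eq_refl[OF abs_of_nonneg[OF G(2)]])+
  have [measurable]: "\<And>k. frac_div \<alpha> (\<psi> k) \<in> borel_measurable lebesgue" "frac_div \<alpha> \<phi> \<in> borel_measurable lebesgue"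
    by (intro borel_measurable_imp_lebesgue; measurable)+
  have "(\<lambda>k. LINT y|lebesgue. f y * frac_div \<alpha> (\<psi> k) y) \<longlonglongrightarrow> (LINT y|lebesgue. f y * frac_div \<alpha> \<phi> y)"
  proof (rule integral_dominated_convergence[where w = "\<lambda>y. norm (f y * ?G y)"])
    show "integrable lebesgue (\<lambda>y. norm (f y * ?G y))" using fG by (rule integrable_norm)
    have "(\<lambda>k. frac_div \<alpha> (\<psi> k) y) \<longlonglongrightarrow> frac_div \<alpha> \<phi> y" for y
      by (rule frac_div_tendsto[OF \<alpha>\<beta> _ lipschitz_bounded_holder[OF \<psi>(2) bd] lim]) auto
    then show "AE y in lebesgue. (\<lambda>k. f y * frac_div \<alpha> (\<psi> k) y) \<longlonglongrightarrow> f y * frac_div \<alpha> \<phi> y"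
      by (intro AE_I2 tendsto_mult_left)
    show "AE y in lebesgue. norm (f y * frac_div \<alpha> (\<psi> k) y) \<le> norm (f y * ?G y)" for k
      unfolding real_norm_def abs_mult[of "f y" for y]
      by (intro AE_I2 mult_left_mono[OF order_trans[OF G' abs_ge_self]] abs_ge_zero)
  qed measurable
  moreover have "(\<lambda>k. - (LINT x|M. \<psi> k x \<bullet> \<nu> x)) \<longlonglongrightarrow> - (LINT x|M. \<phi> x \<bullet> \<nu> x)"
  proof (intro tendsto_minus integral_dominated_convergence[where w = "\<lambda>x. (S + C) * norm (\<nu> x)"])
    show "integrable M (\<lambda>x. (S + C) * norm (\<nu> x))" using fm(3) by simp
    show "AE x in M. (\<lambda>k. \<psi> k x \<bullet> \<nu> x) \<longlonglongrightarrow> \<phi> x \<bullet> \<nu> x"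
      by (intro AE_I2 tendsto_inner lim tendsto_const)
    show "AE x in M. norm (\<psi> k x \<bullet> \<nu> x) \<le> (S + C) * norm (\<nu> x)" for k
    proof (rule AE_I2)
      fix x
      have "norm (\<psi> k x \<bullet> \<nu> x) \<le> norm (\<psi> k x) * norm (\<nu> x)" using Cauchy_Schwarz_ineq2 by simp
      also have "\<dots> \<le> (S + C) * norm (\<nu> x)" using bd by (intro mult_right_mono) auto
      finally show "norm (\<psi> k x \<bullet> \<nu> x) \<le> (S + C) * norm (\<nu> x)" .
    qed
  qed measurable
  moreover have "(LINT y|lebesgue. f y * frac_div \<alpha> (\<psi> k) y) = - (LINT x|M. \<psi> k x \<bullet> \<nu> x)" for k
    by (rule ibp[OF \<psi>(1) Lip_cI(2)[OF \<psi>(2) supp]])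
  ultimately show ?thesis
    by (simp add: LIMSEQ_unique)
qed

subsection \<open>Cutoffs of balls\<close>

text \<open>For fixed y, the singular part of the weight integrates in r to a constant independent
  of y, finite as \<beta> < 1. Fubini then gives integrability in y for almost every r.\<close>

lemma AE_integrable_shell_weight:
  fixes F :: "'a::euclidean_space \<Rightarrow> real"
  assumes F: "integrable lebesgue F" and \<beta>: "0 < \<beta>" "\<beta> < 1"
  shows "AE r in lborel. integrable lebesgue (\<lambda>y. F y * (1 + \<bar>norm (y - x) - r\<bar> powr (-\<beta>)))"
proof -
  have [measurable]: "F \<in> borel_measurable lebesgue" using F by simp
  \<comment> \<open>A Borel representative is needed for measurability on the product of the Borel
    measures.\<close>
  obtain F' where [measurable]: "F' \<in> borel_measurable borel" and "AE y in lborel. F y = F' y"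
    using completion_ex_borel_measurable_real[of F lborel] by auto
  then have eq: "AE y in lebesgue. F y = F' y" by (auto intro: AE_completion)
  have [measurable]: "F' \<in> borel_measurable lebesgue" by (simp add: measurable_completion)
  have "integrable lebesgue F'"
    using F eq by (subst (asm) integrable_cong_AE[of F _ F']) auto
  then have F': "integrable lborel F'" by (simp add: integrable_completion)
  \<comment> \<open>The part of |s|^(-\<beta>) with |s| < 1, hence integrable on the whole line; the
    exponent is written to match \<open>integrable_norm_powr_near_0\<close> in dimension
    one.\<close>
  define K :: "real \<Rightarrow> real" where
    "K = (\<lambda>s. if norm s < 1 then norm s powr ((1 - \<beta>) - DIM(real)) else 0)"
  have K: "integrable lborel K"
    unfolding K_def by (rule integrable_norm_powr_near_0) (use \<beta> in auto)
  have K0: "0 \<le> K s" for s by (simp add: K_def)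
  have [measurable]: "K \<in> borel_measurable borel" using borel_measurable_integrable[OF K] by simp
  let ?f = "\<lambda>y r. F' y * K (r - norm (y - x))"
  have shift: "integrable lborel (\<lambda>r. K (r - c))" "(LINT r|lborel. K (r - c)) = (LINT s|lborel. K s)" for c
    using lborel_integrable_shift[OF K, of "-c"] lborel_integral_shift[of K "-c"] by simp_all
  have meas: "case_prod ?f \<in> borel_measurable (lborel \<Otimes>\<^sub>M lborel)" by measurable
  have "integrable (lborel \<Otimes>\<^sub>M lborel) (case_prod ?f)"
  proof (rule lborel_pair.Fubini_integrable[OF meas])
    have "(LINT r|lborel. norm (case_prod ?f (y, r))) = \<bar>F' y\<bar> * (LINT s|lborel. K s)" for y
      using K0 by (simp add: abs_mult shift)
    then show "integrable lborel (\<lambda>y. LINT r|lborel. norm (case_prod ?f (y, r)))"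
      using F' by simp
    show "AE y in lborel. integrable lborel (\<lambda>r. case_prod ?f (y, r))"
      unfolding split by (intro AE_I2 integrable_mult_right shift)
  qed
  then have "AE r in lborel. integrable lborel (\<lambda>y. ?f y r)"
    by (rule lborel_pair.AE_integrable_snd)
  then show ?thesis
  proof eventually_elim
    case (elim r)
    then have "integrable lebesgue (\<lambda>y. ?f y r)"
      by (subst integrable_completion) auto
    then have b1: "integrable lebesgue (\<lambda>y. norm (?f y r) + 2 * norm (F y))"
      using F by (intro Bochner_Integration.integrable_add integrable_norm integrable_mult_right)
    have b2: "AE y in lebesgue. norm (F y * (1 + \<bar>norm (y - x) - r\<bar> powr (-\<beta>)))
        \<le> norm (norm (?f y r) + 2 * norm (F y))"
      using eq
    proof eventually_elim
      case (elim y)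
      have "\<bar>norm (y - x) - r\<bar> powr (-\<beta>) \<le> K (r - norm (y - x)) + 1"
      proof (cases "\<bar>norm (y - x) - r\<bar> < 1")
        case True
        then show ?thesis by (simp add: K_def abs_minus_commute)
      next
        case False
        then have "\<bar>norm (y - x) - r\<bar> powr (-\<beta>) \<le> 1 powr (-\<beta>)"
          using \<beta> by (intro powr_mono2') auto
        then show ?thesis using K0[of "r - norm (y - x)"] by simp
      qed
      \<comment> \<open>The 2 is the 1 already in the weight plus a 1 for distances at least 1,
        where the power is at most 1.\<close>
      then have "\<bar>F y\<bar> * (1 + \<bar>norm (y - x) - r\<bar> powr (-\<beta>)) \<le> \<bar>F y\<bar> * (K (r - norm (y - x)) + 2)"
        by (intro mult_left_mono) auto
      moreover have "norm (F y * (1 + \<bar>norm (y - x) - r\<bar> powr (-\<beta>)))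
          = \<bar>F y\<bar> * (1 + \<bar>norm (y - x) - r\<bar> powr (-\<beta>))"
        by (simp only: real_norm_def abs_mult) (simp add: add_nonneg_nonneg)
      ultimately show ?case
        using elim K0[of "r - norm (y - x)"] by (simp add: abs_mult distrib_left mult.commute)
    qed
    have [measurable]: "(\<lambda>y. \<bar>norm (y - x) - r\<bar> powr (-\<beta>)) \<in> borel_measurable lebesgue"
      by (rule borel_measurable_imp_lebesgue) measurable
    show ?case
      by (rule Bochner_Integration.integrable_bound[OF b1 _ b2]) measurable
  qed
qed

section \<open>Radial cutoffs with bounds uniform in the slope\<close>

definition ball_cutoff :: "real \<Rightarrow> 'a::euclidean_space \<Rightarrow> real \<Rightarrow> 'a \<Rightarrow> real" where
  "ball_cutoff m x r z = min 1 (max 0 (m * (r - norm (z - x))))"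

lemma ball_cutoff_range: "0 \<le> ball_cutoff m x r z" "ball_cutoff m x r z \<le> 1"
  by (auto simp: ball_cutoff_def)

lemma ball_cutoff_lipschitz:
  assumes "0 \<le> m"
  shows "\<bar>ball_cutoff m x r z - ball_cutoff m x r y\<bar> \<le> m * norm (z - y)"
proof -
  have "\<bar>min 1 (max 0 u) - min 1 (max 0 v)\<bar> \<le> \<bar>u - v\<bar>" for u v :: real by auto
  then have "\<bar>ball_cutoff m x r z - ball_cutoff m x r y\<bar>
      \<le> \<bar>m * (r - norm (z - x)) - m * (r - norm (y - x))\<bar>"
    unfolding ball_cutoff_def .
  also have "\<dots> = m * \<bar>norm (y - x) - norm (z - x)\<bar>"
    using assms by (simp add: abs_mult flip: right_diff_distrib)
  also have "\<dots> \<le> m * norm (z - y)"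
    using assms norm_triangle_ineq3[of "y - x" "z - x"]
    by (intro mult_left_mono) (auto simp: norm_minus_commute)
  finally show ?thesis .
qed

text \<open>The cutoffs vanish on the sphere and outside, so convergence holds at every point.
  Almost everywhere convergence for Lebesgue measure would not do for \<open>M\<close>.\<close>

lemma ball_cutoff_tendsto: "(\<lambda>k. ball_cutoff (real k) x r z) \<longlonglongrightarrow> indicator (ball x r) z"
proof (cases "norm (z - x) < r")
  case True
  then obtain N where N: "1 < real N * (r - norm (z - x))"
    using reals_Archimedean3[of "r - norm (z - x)"] by auto
  have "\<forall>\<^sub>F k in sequentially. ball_cutoff (real k) x r z = 1"
    using eventually_ge_at_top[of N]
  proof eventually_elim
    case (elim k)
    then have "real N * (r - norm (z - x)) \<le> real k * (r - norm (z - x))"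
      using True by (intro mult_right_mono) auto
    then show ?case using N by (simp add: ball_cutoff_def)
  qed
  then show ?thesis
    using True by (simp add: tendsto_eventually dist_norm norm_minus_commute)
next
  case False
  have "ball_cutoff (real k) x r z = 0" for k
    using False by (simp add: ball_cutoff_def mult_nonneg_nonpos)
  then show ?thesis using False by (simp add: dist_norm norm_minus_commute)
qed

text \<open>A bound uniform in the slope \<open>m\<close>: near a point at distance \<open>d\<close> from the sphere,
  either the cutoff is constant on the ball of radius \<open>d / 2\<close>, or \<open>m < 2 / d\<close>.\<close>
lemma ball_cutoff_diff_le:
  assumes "0 \<le> m" and d: "0 < \<bar>norm (y - x) - r\<bar>"
  shows "\<bar>ball_cutoff m x r z - ball_cutoff m x r y\<bar>
    \<le> min 1 (2 * norm (z - y) / \<bar>norm (y - x) - r\<bar>)"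
proof -
  define t d where "t = norm (z - y)" and "d = \<bar>norm (y - x) - r\<bar>"
  have "0 < d" "0 \<le> t" using assms by (auto simp: t_def d_def)
  have t: "\<bar>norm (y - x) - norm (z - x)\<bar> \<le> t"
    using norm_triangle_ineq3[of "y - x" "z - x"] by (simp add: t_def norm_minus_commute)
  have one: "\<bar>ball_cutoff m x r z - ball_cutoff m x r y\<bar> \<le> 1"
    using ball_cutoff_range[of m x r z] ball_cutoff_range[of m x r y] by linarith
  have "\<bar>ball_cutoff m x r z - ball_cutoff m x r y\<bar> \<le> 2 * t / d"
  proof (cases "d \<le> 2 * t")
    case True
    then have "1 \<le> 2 * t / d" using \<open>0 < d\<close> by simp
    then show ?thesis using one by linarith
  next
    case False
    have nonneg: "0 \<le> 2 * t / d" using \<open>0 \<le> t\<close> \<open>0 < d\<close> by simp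
    \<comment> \<open>With |z - y| < d/2, the point z stays on the side of y. Outside, both values
      are 0; inside with m d >= 2, both points have depth at least d/2, so both values are 1;
      otherwise the slope is below 2/d.\<close>
    consider "norm (y - x) > r" | "norm (y - x) < r" "2 \<le> m * d" | "m * d < 2" using d by linarith
    then show ?thesis
    proof cases
      case 1
      then have "norm (z - x) \<ge> r" using False t by (simp add: d_def)
      then have "ball_cutoff m x r z = 0" "ball_cutoff m x r y = 0"
        using 1 assms(1) by (auto simp: ball_cutoff_def mult_nonneg_nonpos)
      then show ?thesis using nonneg by simp
    next
      case 2
      then have *: "d / 2 \<le> r - norm (z - x)" "d / 2 \<le> r - norm (y - x)" using False t by (auto simp: d_def)
      have "m * (d / 2) \<le> m * (r - norm (z - x))" "m * (d / 2) \<le> m * (r - norm (y - x))"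
        using *[THEN mult_left_mono, OF assms(1)] .
      then have "ball_cutoff m x r z = 1" "ball_cutoff m x r y = 1"
        using 2(2) by (auto simp: ball_cutoff_def)
      then show ?thesis using nonneg by simp
    next
      case 3
      then have "m \<le> 2 / d" using \<open>0 < d\<close> by (simp add: pos_le_divide_eq)
      then have "m * t \<le> 2 / d * t" using \<open>0 \<le> t\<close> by (intro mult_right_mono)
      then show ?thesis
        using ball_cutoff_lipschitz[OF assms(1), of x r z y] by (simp add: t_def)
    qed
  qed
  then show ?thesis using one by (simp add: t_def d_def)
qed

text \<open>Since min(1, q) <= q^\<beta>, order 1 is traded for order \<beta>, which replaces the
  non-integrable 1/d by d^(-\<beta>). The 1 added to the power covers t > 1 with d large.\<close>

lemma min_one_divide_le_holder:
  assumes "0 \<le> t" "0 < d" "0 < \<beta>" "\<beta> \<le> (1::real)"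
  shows "min 1 (2 * t / d) \<le> 2 * (1 + d powr (-\<beta>)) * min 1 (t powr \<beta>)"
proof -
  define q where "q = 2 * t / d"
  have "0 \<le> q" using assms by (simp add: q_def)
  have "min 1 q \<le> q powr \<beta>"
  proof (cases "q \<le> 1")
    case True
    then show ?thesis using powr_mono'[of \<beta> 1 q] \<open>0 \<le> q\<close> assms by simp
  next
    case False
    then show ?thesis using assms by (simp add: min_absorb1 ge_one_powr_ge_zero)
  qed
  also have "\<dots> = 2 powr \<beta> * (t powr \<beta> * d powr (-\<beta>))"
    using assms by (simp add: q_def powr_mult powr_divide powr_minus_divide)
  also have "\<dots> \<le> 2 * (t powr \<beta> * d powr (-\<beta>))"
    using powr_mono[of \<beta> 1 2] assms by (intro mult_right_mono) auto
  finally have 1: "min 1 q \<le> 2 * (t powr \<beta> * d powr (-\<beta>))" .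
  have d0: "0 \<le> d powr (-\<beta>)" by simp
  show ?thesis
  proof (cases "t powr \<beta> \<le> 1")
    case True
    then have "2 * (1 + d powr (-\<beta>)) * min 1 (t powr \<beta>) = 2 * t powr \<beta> + 2 * (t powr \<beta> * d powr (-\<beta>))"
      by (simp add: min_absorb2 algebra_simps)
    then show ?thesis using 1 powr_ge_zero[of t \<beta>] unfolding q_def by linarith
  next
    case False
    then have "2 * (1 + d powr (-\<beta>)) * min 1 (t powr \<beta>) = 2 * (1 + d powr (-\<beta>))"
      by simp
    moreover have "1 \<le> 2 * (1 + d powr (-\<beta>))" using d0 by simp
    ultimately show ?thesis by (simp only: order_trans[OF min.cobounded1])
  qed
qed

lemma Lip_c_ball_cutoff:
  fixes \<phi> :: "'a::euclidean_space \<Rightarrow> 'b::real_normed_vector"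
  assumes "\<phi> \<in> Lip_c" "0 \<le> m"
  shows "(\<lambda>z. ball_cutoff m x r z *\<^sub>R \<phi> z) \<in> Lip_c"
proof -
  obtain C R S where C: "C-lipschitz_on UNIV \<phi>" and "0 < R" "0 \<le> S"
    and R: "\<And>x. R \<le> norm x \<Longrightarrow> \<phi> x = 0" and S: "\<And>x. norm (\<phi> x) \<le> S"
    using Lip_cE[OF assms(1)] by blast
  have C0: "0 \<le> C" using lipschitz_on_nonneg[OF C] .
  have "(C + m * S)-lipschitz_on UNIV (\<lambda>z. ball_cutoff m x r z *\<^sub>R \<phi> z)"
  proof (rule lipschitz_onI)
    fix z y
    have "ball_cutoff m x r z *\<^sub>R \<phi> z - ball_cutoff m x r y *\<^sub>R \<phi> y
        = ball_cutoff m x r z *\<^sub>R (\<phi> z - \<phi> y) + (ball_cutoff m x r z - ball_cutoff m x r y) *\<^sub>R \<phi> y"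
      by (simp add: algebra_simps)
    also have "norm \<dots> \<le> ball_cutoff m x r z * norm (\<phi> z - \<phi> y)
        + \<bar>ball_cutoff m x r z - ball_cutoff m x r y\<bar> * norm (\<phi> y)"
      using ball_cutoff_range(1)[of m x r z] by (intro norm_triangle_le) simp
    also have "\<dots> \<le> 1 * (C * dist z y) + (m * norm (z - y)) * S"
      using ball_cutoff_range[of m x r z] ball_cutoff_lipschitz[OF assms(2)] S assms(2)
        lipschitz_onD[OF C, of z y]
      by (intro add_mono mult_mono) (auto simp: dist_norm)
    finally show "dist (ball_cutoff m x r z *\<^sub>R \<phi> z) (ball_cutoff m x r y *\<^sub>R \<phi> y) \<le> (C + m * S) * dist z y"
      by (simp add: dist_norm algebra_simps)
  qed (use C0 \<open>0 \<le> S\<close> assms in simp)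
  then show ?thesis by (rule Lip_cI(1)[where R = R]) (use R in simp)
qed

section \<open>Passage to the ball and splitting of the limit\<close>

theorem theorem3p13:
  fixes f :: "'a::euclidean_space \<Rightarrow> real" and \<phi> :: "'a \<Rightarrow> 'a"
    and \<alpha> :: real and p :: ereal and x :: 'a
    and M :: "'a measure" and \<nu> :: "'a \<Rightarrow> 'a"
  assumes "0 < \<alpha>" "\<alpha> < 1"
    and "ereal (1 / (1 - \<alpha>)) < p"
    and "f \<in> BV_frac \<alpha> p"
    and "is_frac_grad_measure \<alpha> f M \<nu>"
    and "\<phi> \<in> Lip_c"
  shows "AE r in lborel. 0 < r \<longrightarrow>
    (LINT y:ball x r|lebesgue. f y * frac_div \<alpha> \<phi> y)
    + (LINT y|lebesgue. f y * (\<phi> y \<bullet> frac_grad \<alpha> (indicator (ball x r)) y))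
    + (LINT y|lebesgue. f y * frac_div_NL \<alpha> (indicator (ball x r)) \<phi> y)
    = - (LINT y:ball x r|M. \<phi> y \<bullet> \<nu> y)"
proof -
  obtain C R S where C: "C-lipschitz_on UNIV \<phi>" and "0 < R" "0 \<le> S"
    and R: "\<And>x. R \<le> norm x \<Longrightarrow> \<phi> x = 0" and S: "\<And>x. norm (\<phi> x) \<le> S"
    using Lip_cE[OF assms(6)] by blast
  have C0: "0 \<le> C" using lipschitz_on_nonneg[OF C] .
  \<comment> \<open>The midpoint of \<alpha> and 1: above \<alpha> for the kernel, below 1 for the
    shell weight.\<close>
  define \<beta> where "\<beta> = (1 + \<alpha>) / 2"
  have \<alpha>\<beta>: "0 < \<alpha>" "\<alpha> < \<beta>" "\<beta> \<le> 1" and \<beta>: "0 < \<beta>" "\<beta> < 1"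
    using assms(1,2) by (auto simp: \<beta>_def)
  have "ereal 1 \<le> ereal (1 / (1 - \<alpha>))" using assms(1,2) by simp
  then have p: "1 \<le> p" using assms(3) unfolding one_ereal_def by (rule order_trans[OF _ less_imp_le])
  have f: "f \<in> Lp p" using assms(4) by (simp add: BV_frac_def)
  have [measurable]: "f \<in> borel_measurable lebesgue" using f by (simp add: Lp_def)
  have [measurable]: "\<phi> \<in> borel_measurable borel"
    using lipschitz_on_continuous_on[OF C] by (rule borel_measurable_continuous_onI)
  have \<phi>_leb [measurable]: "\<phi> \<in> borel_measurable lebesgue"
    by (rule borel_measurable_imp_lebesgue) measurable
  have fm: "sets M = sets borel" "integrable M \<nu>"
    using assms(5) by (auto simp: is_frac_grad_measure_def)
  have [measurable_cong]: "sets M = sets borel" by (rule fm)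
  have [measurable]: "\<nu> \<in> borel_measurable M" using fm(2) by simp
  define \<mu> where "\<mu> = \<bar>frac_const DIM('a) \<alpha>\<bar>"
  define J where "J = (LINT w|lborel. frac_kernel \<alpha> \<beta> (w::'a))"
  define A where "A = C + 2 * S"
  have A: "0 \<le> A" and \<mu>: "0 \<le> \<mu>" using C0 \<open>0 \<le> S\<close> by (auto simp: A_def \<mu>_def)
  define G :: "'a \<Rightarrow> real" where "G = (\<lambda>y. \<mu> * (A * support_majorant \<alpha> \<beta> R y))"
  have G: "integrable lborel G" "\<And>y. 0 \<le> G y" "\<And>y. G y \<le> \<mu> * (A * (2 * J))"
    using A \<mu> integrable_support_majorant[OF \<alpha>\<beta>, where 'a = 'a]
      support_majorant_nonneg[OF \<alpha>\<beta>, where 'a = 'a] support_majorant_le[OF \<alpha>\<beta>, where 'a = 'a]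
    by (auto simp: G_def J_def intro!: mult_left_mono)
  have Gm [measurable]: "G \<in> borel_measurable lebesgue"
    by (intro measurable_completion borel_measurable_integrable[OF G(1)])
  have fG: "integrable lebesgue (\<lambda>y. f y * G y)"
    by (rule Lp_mult_integrable[OF f p Gm _ G]) (use G(2) in simp)
  have f\<phi>: "integrable lebesgue (\<lambda>y. f y * norm (\<phi> y))"
  proof (rule Lp_mult_integrable[OF f p, where G = "\<lambda>y. S * indicator (ball 0 R) y" and K = S])
    show "integrable lborel (\<lambda>y::'a. S * indicator (ball 0 R) y)"
      using emeasure_bounded_finite[OF bounded_ball[of "0::'a" R]] by (simp add: integrable_indicator_iff)
    show "AE y in lebesgue. \<bar>norm (\<phi> y)\<bar> \<le> S * indicator (ball 0 R) y"
      using S R by (intro AE_I2) (auto simp: indicator_def)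
  qed (use \<open>0 \<le> S\<close> in \<open>auto simp: indicator_def\<close>)
  \<comment> \<open>The only place where radii are discarded.\<close>
  show ?thesis
    using AE_integrable_shell_weight[OF f\<phi> \<beta>, of x]
  proof eventually_elim
    case (elim r)
    \<comment> \<open>The Hoelder factor at y common to all cutoffs, independent of k.\<close>
    define W where "W = (\<lambda>y. 2 * (1 + \<bar>norm (y - x) - r\<bar> powr (-\<beta>)))"
    define \<eta> :: "'a \<Rightarrow> real" where "\<eta> = indicator (ball x r)"
    have [measurable]: "\<eta> \<in> borel_measurable borel" unfolding \<eta>_def by measurable
    have \<eta>1: "\<bar>\<eta> z - \<eta> y\<bar> \<le> 1" for z y by (simp add: \<eta>_def indicator_def)
    define h where "h = (\<lambda>k::nat. ball_cutoff (real k) x r)"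
    have [measurable]: "h k \<in> borel_measurable borel" for k
      unfolding h_def ball_cutoff_def[abs_def] by measurable
    have h\<eta>: "(\<lambda>k. h k z) \<longlonglongrightarrow> \<eta> z" for z
      unfolding h_def \<eta>_def by (rule ball_cutoff_tendsto)
    have h01: "0 \<le> h k z" "h k z \<le> 1" for k z
      unfolding h_def by (rule ball_cutoff_range)+
    have hW: "\<bar>h k z - h k y\<bar> \<le> W y * min 1 (norm (z - y) powr \<beta>)" if "norm (y - x) \<noteq> r" for k z y
    proof -
      have d: "0 < \<bar>norm (y - x) - r\<bar>" using that by simp
      have "\<bar>h k z - h k y\<bar> \<le> min 1 (2 * norm (z - y) / \<bar>norm (y - x) - r\<bar>)"
        unfolding h_def by (rule ball_cutoff_diff_le[OF _ d]) simp
      also have "\<dots> \<le> W y * min 1 (norm (z - y) powr \<beta>)"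
        unfolding W_def by (rule min_one_divide_le_holder[OF norm_ge_zero d \<beta>(1) \<alpha>\<beta>(3)])
      finally show ?thesis .
    qed
    have \<eta>W: "\<bar>\<eta> z - \<eta> y\<bar> \<le> W y * min 1 (norm (z - y) powr \<beta>)" if "norm (y - x) \<noteq> r" for z y
    proof (rule LIMSEQ_le_const2)
      show "(\<lambda>k. \<bar>h k z - h k y\<bar>) \<longlonglongrightarrow> \<bar>\<eta> z - \<eta> y\<bar>"
        by (intro tendsto_rabs tendsto_diff h\<eta>)
      show "\<exists>N. \<forall>k\<ge>N. \<bar>h k z - h k y\<bar> \<le> W y * min 1 (norm (z - y) powr \<beta>)"
        using hW[OF that] by blast
    qed
    \<comment> \<open>The bounds through \<open>W\<close> are available only off the sphere, which
      is harmless in every integral against \<open>f\<close>.\<close>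
    have sphere: "AE y in lebesgue. norm (y - x) \<noteq> r"
    proof -
      have "sphere x r \<in> null_sets lebesgue"
        using negligible_sphere negligible_iff_null_sets by blast
      from AE_not_in[OF this] show ?thesis
        by eventually_elim (simp add: dist_norm norm_minus_commute)
    qed
    \<comment> \<open>\<open>G\<close> handles increments of \<phi>, where the cutoff is at most 1;
      the second term handles increments of the cutoff, which multiply \<phi>(y).\<close>
    define H where "H = (\<lambda>y. G y + \<mu> * (norm (\<phi> y) * W y * J))"
    have Wint: "integrable lebesgue (\<lambda>y. f y * (\<mu> * (norm (\<phi> y) * W y * J)))"
    proof -
      have "(\<lambda>y. f y * (\<mu> * (norm (\<phi> y) * W y * J)))
          = (\<lambda>y. (2 * \<mu> * J) * (f y * norm (\<phi> y) * (1 + \<bar>norm (y - x) - r\<bar> powr (-\<beta>))))"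
        by (simp add: W_def mult_ac)
      then show ?thesis using elim by simp
    qed
    have fH: "integrable lebesgue (\<lambda>y. f y * H y)"
      unfolding H_def distrib_left by (intro Bochner_Integration.integrable_add fG Wint)
    \<comment> \<open>Placing \<phi> at the base point y in the cutoff term confines the singular
      weight to the support of \<phi>, where \<open>f\<close> is integrable.\<close>
    have diff: "norm (h k z *\<^sub>R \<phi> z - h k y *\<^sub>R \<phi> y)
        \<le> (A * (indicator (ball 0 R) z + indicator (ball 0 R) y) + norm (\<phi> y) * W y) * min 1 (norm (z - y) powr \<beta>)"
      if "norm (y - x) \<noteq> r" for k z y
    proof -
      have "h k z *\<^sub>R \<phi> z - h k y *\<^sub>R \<phi> y = h k z *\<^sub>R (\<phi> z - \<phi> y) + (h k z - h k y) *\<^sub>R \<phi> y"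
        by (simp add: algebra_simps)
      also have "norm \<dots> \<le> h k z * norm (\<phi> z - \<phi> y) + \<bar>h k z - h k y\<bar> * norm (\<phi> y)"
        using h01[of k z] by (intro norm_triangle_le) simp
      also have "\<dots> \<le> 1 * norm (\<phi> z - \<phi> y) + (W y * min 1 (norm (z - y) powr \<beta>)) * norm (\<phi> y)"
        using h01[of k z] hW[OF that] by (intro add_mono mult_right_mono) auto
      also have "\<dots> \<le> (A * (indicator (ball 0 R) z + indicator (ball 0 R) y)) * min 1 (norm (z - y) powr \<beta>)
          + (W y * min 1 (norm (z - y) powr \<beta>)) * norm (\<phi> y)"
        using lipschitz_compact_support_holder[where z = z and y = y, OF C S R \<beta>(1) \<alpha>\<beta>(3)] by (simp add: A_def)
      finally show ?thesis by (simp add: algebra_simps)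
    qed
    have bound: "\<bar>frac_div \<alpha> (\<lambda>z. h k z *\<^sub>R \<phi> z) y\<bar> \<le> H y" if y: "norm (y - x) \<noteq> r" for k y
    proof -
      have i1: "integrable lborel (\<lambda>z. A * ((indicator (ball 0 R) z + indicator (ball 0 R) y) * frac_kernel \<alpha> \<beta> (z - y)))"
        by (intro integrable_mult_right integrable_support_majorant_integrand[OF \<alpha>\<beta>])
      have i2: "integrable lborel (\<lambda>z. (norm (\<phi> y) * W y) * frac_kernel \<alpha> \<beta> (z - y))"
        by (intro integrable_mult_right frac_kernel_shift(1)[OF \<alpha>\<beta>])
      have eq: "(A * (indicator (ball 0 R) z + indicator (ball 0 R) y) + norm (\<phi> y) * W y) * frac_kernel \<alpha> \<beta> (z - y)
          = A * ((indicator (ball 0 R) z + indicator (ball 0 R) y) * frac_kernel \<alpha> \<beta> (z - y))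
            + (norm (\<phi> y) * W y) * frac_kernel \<alpha> \<beta> (z - y)" for z
        by (simp only: distrib_right mult.assoc)
      have "\<bar>frac_div \<alpha> (\<lambda>z. h k z *\<^sub>R \<phi> z) y\<bar> \<le> \<mu> * (LINT z|lborel.
          (A * (indicator (ball 0 R) z + indicator (ball 0 R) y) + norm (\<phi> y) * W y) * frac_kernel \<alpha> \<beta> (z - y))"
        unfolding \<mu>_def
        by (rule frac_div_le[OF _ _ diff[OF y]], measurable, unfold eq)
          (intro Bochner_Integration.integrable_add i1 i2)
      also have "\<dots> = H y"
        unfolding eq Bochner_Integration.integral_add[OF i1 i2] integral_mult_right_zero
          frac_kernel_shift(2)[OF \<alpha>\<beta>] H_def G_def J_def support_majorant_def
        by (simp add: distrib_left)
      finally show ?thesis .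
    qed
    have lim: "(\<lambda>k. frac_div \<alpha> (\<lambda>z. h k z *\<^sub>R \<phi> z) y) \<longlonglongrightarrow> frac_div \<alpha> (\<lambda>z. \<eta> z *\<^sub>R \<phi> z) y"
      if y: "norm (y - x) \<noteq> r" for y
    proof (rule frac_div_tendsto[OF \<alpha>\<beta>, where B = "A * 2 + norm (\<phi> y) * W y"])
      show "norm (h k z *\<^sub>R \<phi> z - h k y *\<^sub>R \<phi> y) \<le> (A * 2 + norm (\<phi> y) * W y) * min 1 (norm (z - y) powr \<beta>)" for k z
      proof (rule order_trans[OF diff[OF y]])
        have "A * (indicator (ball 0 R) z + indicator (ball 0 R) y) \<le> A * 2"
          using A by (intro mult_left_mono) (auto simp: indicator_def)
        then show "(A * (indicator (ball 0 R) z + indicator (ball 0 R) y) + norm (\<phi> y) * W y) * min 1 (norm (z - y) powr \<beta>)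
            \<le> (A * 2 + norm (\<phi> y) * W y) * min 1 (norm (z - y) powr \<beta>)"
          by (intro mult_right_mono) auto
      qed
      show "(\<lambda>k. h k z *\<^sub>R \<phi> z) \<longlonglongrightarrow> \<eta> z *\<^sub>R \<phi> z" for z
        by (intro tendsto_scaleR h\<eta> tendsto_const)
    qed measurable
    have [measurable]: "\<And>k. frac_div \<alpha> (\<lambda>z. h k z *\<^sub>R \<phi> z) \<in> borel_measurable lebesgue"
      "frac_div \<alpha> (\<lambda>z. \<eta> z *\<^sub>R \<phi> z) \<in> borel_measurable lebesgue"
      "frac_div \<alpha> \<phi> \<in> borel_measurable lebesgue" "frac_grad \<alpha> \<eta> \<in> borel_measurable lebesgue"
      "frac_div_NL \<alpha> \<eta> \<phi> \<in> borel_measurable lebesgue" "\<eta> \<in> borel_measurable lebesgue"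
      by (intro borel_measurable_imp_lebesgue; measurable)+
    have "(\<lambda>k. LINT y|lebesgue. f y * frac_div \<alpha> (\<lambda>z. h k z *\<^sub>R \<phi> z) y)
        \<longlonglongrightarrow> (LINT y|lebesgue. f y * frac_div \<alpha> (\<lambda>z. \<eta> z *\<^sub>R \<phi> z) y)"
    proof (rule integral_dominated_convergence[where w = "\<lambda>y. norm (f y * H y)"])
      show "integrable lebesgue (\<lambda>y. norm (f y * H y))" using fH by (rule integrable_norm)
      show "AE y in lebesgue. (\<lambda>k. f y * frac_div \<alpha> (\<lambda>z. h k z *\<^sub>R \<phi> z) y)
          \<longlonglongrightarrow> f y * frac_div \<alpha> (\<lambda>z. \<eta> z *\<^sub>R \<phi> z) y"
        using sphere by eventually_elim (intro tendsto_mult_left lim)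
      show "AE y in lebesgue. norm (f y * frac_div \<alpha> (\<lambda>z. h k z *\<^sub>R \<phi> z) y) \<le> norm (f y * H y)" for k
        unfolding real_norm_def abs_mult[of "f y" for y]
        using sphere
        by eventually_elim (intro mult_left_mono[OF order_trans[OF bound abs_ge_self]] abs_ge_zero)
    qed measurable
    moreover have "(\<lambda>k. - (LINT y|M. (h k y *\<^sub>R \<phi> y) \<bullet> \<nu> y)) \<longlonglongrightarrow> - (LINT y|M. (\<eta> y *\<^sub>R \<phi> y) \<bullet> \<nu> y)"
    proof (intro tendsto_minus integral_dominated_convergence[where w = "\<lambda>y. S * norm (\<nu> y)"])
      show "integrable M (\<lambda>y. S * norm (\<nu> y))" using fm(2) by simp
      show "AE y in M. (\<lambda>k. (h k y *\<^sub>R \<phi> y) \<bullet> \<nu> y) \<longlonglongrightarrow> (\<eta> y *\<^sub>R \<phi> y) \<bullet> \<nu> y"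
        by (intro AE_I2 tendsto_inner tendsto_scaleR h\<eta> tendsto_const)
      show "AE y in M. norm ((h k y *\<^sub>R \<phi> y) \<bullet> \<nu> y) \<le> S * norm (\<nu> y)" for k
      proof (rule AE_I2)
        fix y
        have "norm ((h k y *\<^sub>R \<phi> y) \<bullet> \<nu> y) \<le> norm (h k y *\<^sub>R \<phi> y) * norm (\<nu> y)"
          using Cauchy_Schwarz_ineq2[of "h k y *\<^sub>R \<phi> y" "\<nu> y"] by simp
        also have "norm (h k y *\<^sub>R \<phi> y) \<le> 1 * S"
          unfolding norm_scaleR using h01[of k y] S[of y] by (intro mult_mono) auto
        then have "norm (h k y *\<^sub>R \<phi> y) * norm (\<nu> y) \<le> S * norm (\<nu> y)"
          by (intro mult_right_mono) auto
        finally show "norm ((h k y *\<^sub>R \<phi> y) \<bullet> \<nu> y) \<le> S * norm (\<nu> y)" .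
      qed
    qed measurable
    moreover have "(LINT y|lebesgue. f y * frac_div \<alpha> (\<lambda>z. h k z *\<^sub>R \<phi> z) y) = - (LINT y|M. (h k y *\<^sub>R \<phi> y) \<bullet> \<nu> y)" for k
      unfolding h_def
      by (rule frac_integration_by_parts_Lip_c[OF assms(1,2) f p assms(5) Lip_c_ball_cutoff[OF assms(6)]]) simp
    ultimately have main: "(LINT y|lebesgue. f y * frac_div \<alpha> (\<lambda>z. \<eta> z *\<^sub>R \<phi> z) y) = - (LINT y|M. (\<eta> y *\<^sub>R \<phi> y) \<bullet> \<nu> y)"
      by (simp add: LIMSEQ_unique)
    have t1: "integrable lebesgue (\<lambda>y. f y * (\<eta> y * frac_div \<alpha> \<phi> y))"
    proof (rule Lp_mult_integrable[OF f p _ _ G])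
      show "AE y in lebesgue. \<bar>\<eta> y * frac_div \<alpha> \<phi> y\<bar> \<le> G y"
      proof (rule AE_I2)
        fix y
        have "\<bar>frac_div \<alpha> \<phi> y\<bar> \<le> G y"
          unfolding G_def \<mu>_def A_def by (rule frac_div_le_support_majorant(1)[OF \<alpha>\<beta> C S R])
        then show "\<bar>\<eta> y * frac_div \<alpha> \<phi> y\<bar> \<le> G y"
          using G(2)[of y] by (auto simp: \<eta>_def indicator_def)
      qed
    qed measurable
    have t2: "integrable lebesgue (\<lambda>y. f y * (\<phi> y \<bullet> frac_grad \<alpha> \<eta> y))"
    proof (rule Bochner_Integration.integrable_bound[OF Wint])
      show "AE y in lebesgue. norm (f y * (\<phi> y \<bullet> frac_grad \<alpha> \<eta> y)) \<le> norm (f y * (\<mu> * (norm (\<phi> y) * W y * J)))"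
        unfolding real_norm_def abs_mult[of "f y" for y]
        using sphere
      proof eventually_elim
        case (elim y)
        have "norm (frac_grad \<alpha> \<eta> y) \<le> \<mu> * (LINT z|lborel. W y * frac_kernel \<alpha> \<beta> (z - y))"
          unfolding \<mu>_def
          by (rule frac_grad_le[OF _ integrable_mult_right[OF frac_kernel_shift(1)[OF \<alpha>\<beta>]] \<eta>W[OF elim]]) measurable
        then have g: "norm (frac_grad \<alpha> \<eta> y) \<le> \<mu> * (W y * J)"
          by (simp add: frac_kernel_shift(2)[OF \<alpha>\<beta>] J_def)
        have "\<bar>\<phi> y \<bullet> frac_grad \<alpha> \<eta> y\<bar> \<le> norm (\<phi> y) * norm (frac_grad \<alpha> \<eta> y)"
          by (rule Cauchy_Schwarz_ineq2)
        also have "\<dots> \<le> norm (\<phi> y) * (\<mu> * (W y * J))"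
          using g by (intro mult_left_mono) auto
        finally have "\<bar>\<phi> y \<bullet> frac_grad \<alpha> \<eta> y\<bar> \<le> \<mu> * (norm (\<phi> y) * W y * J)"
          by (simp only: mult_ac)
        then show ?case
          by (intro mult_left_mono[OF order_trans[OF _ abs_ge_self]] abs_ge_zero)
      qed
    qed measurable
    \<comment> \<open>Increments of the indicator are at most 1, so those of \<phi> alone dominate
      and no shell weight enters.\<close>
    have t3: "integrable lebesgue (\<lambda>y. f y * frac_div_NL \<alpha> \<eta> \<phi> y)"
    proof (rule Lp_mult_integrable[OF f p _ _ G])
      show "AE y in lebesgue. \<bar>frac_div_NL \<alpha> \<eta> \<phi> y\<bar> \<le> G y"
        unfolding G_def \<mu>_def A_def
        by (intro AE_I2 frac_div_le_support_majorant(2)[OF \<alpha>\<beta> C S R] \<eta>1) measurable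
    qed measurable
    have "(LINT y|lebesgue. f y * frac_div \<alpha> (\<lambda>z. \<eta> z *\<^sub>R \<phi> z) y)
        = (LINT y|lebesgue. f y * (\<eta> y * frac_div \<alpha> \<phi> y) + f y * (\<phi> y \<bullet> frac_grad \<alpha> \<eta> y) + f y * frac_div_NL \<alpha> \<eta> \<phi> y)"
    proof (rule integral_cong_AE)
      show "AE y in lebesgue. f y * frac_div \<alpha> (\<lambda>z. \<eta> z *\<^sub>R \<phi> z) y
          = f y * (\<eta> y * frac_div \<alpha> \<phi> y) + f y * (\<phi> y \<bullet> frac_grad \<alpha> \<eta> y) + f y * frac_div_NL \<alpha> \<eta> \<phi> y"
        using sphere
      proof eventually_elim
        case (elim y)
        have "frac_div \<alpha> (\<lambda>z. \<eta> z *\<^sub>R \<phi> z) y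
            = \<eta> y * frac_div \<alpha> \<phi> y + \<phi> y \<bullet> frac_grad \<alpha> \<eta> y + frac_div_NL \<alpha> \<eta> \<phi> y"
          by (rule frac_div_leibniz[OF \<alpha>\<beta> _ _ \<eta>W[OF elim] \<eta>1 lipschitz_bounded_holder[OF C S \<beta>(1) \<alpha>\<beta>(3)]])
            measurable
        then show ?case by (simp only: distrib_left)
      qed
    qed measurable
    also have "\<dots> = (LINT y|lebesgue. f y * (\<eta> y * frac_div \<alpha> \<phi> y))
        + (LINT y|lebesgue. f y * (\<phi> y \<bullet> frac_grad \<alpha> \<eta> y)) + (LINT y|lebesgue. f y * frac_div_NL \<alpha> \<eta> \<phi> y)"
      unfolding Bochner_Integration.integral_add[OF Bochner_Integration.integrable_add[OF t1 t2] t3]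
        Bochner_Integration.integral_add[OF t1 t2] ..
    finally show ?case
      using main by (simp add: \<eta>_def set_lebesgue_integral_def mult_ac)
  qed
qed

end
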